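(* For every integer $k \geq 1$, $$ gr_{k}(K_{3}:W_{5})=\begin{cases} 5 & \text{ if $k = 1$,}\\ 14\cdot5^{\frac{k-2}{2}}+1 & \text{ if $k$ is even,}\\ 28\cdot5^{\frac{k-3}{2}}+1 & \text{ if $k \geq 3$ is odd.} \end{cases} $$
   Context: The wheel $W_5 = K_1 \vee C_4$ is the graph on $5$ vertices consisting of a $4$-cycle and a vertex adjacent to all four cycle vertices. For graphs $G$, $H$ and a positive integer $k$, the Gallai-Ramsey number $gr_k(G:H)$ is the minimum integer $m$ such that every coloring of the edges of $K_m$ using at most $k$ colors contains either a rainbow copy of $G$ (all edges receiving distinct colors) or a monochromatic copy of $H$. *)

theory Defs
  imports Main "HOL-Library.FuncSet" "HOL-Library.Ramsey"
begin

text \<open>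
  A graph is a pair of a vertex set and an edge set; edges are two-element sets of vertices.
\<close>

type_synonym 'a graph = "'a set \<times> 'a set set"

abbreviation verts :: "'a graph \<Rightarrow> 'a set" where
  "verts G \<equiv> fst G"

abbreviation edges :: "'a graph \<Rightarrow> 'a set set" where
  "edges G \<equiv> snd G"

definition complete_graph :: "nat \<Rightarrow> nat graph" where
  "complete_graph n = ({..<n}, nsets {..<n} 2)"

text \<open>Meaningful only for \<open>n \<ge> 3\<close>.\<close>

definition cycle_graph :: "nat \<Rightarrow> nat graph" where
  "cycle_graph n = ({..<n}, {{i, (i + 1) mod n} | i. i < n})"

definition graph_join :: "'a graph \<Rightarrow> 'b graph \<Rightarrow> ('a + 'b) graph" where
  "graph_join G H =
    (verts G <+> verts H,
     (\<lambda>e. Inl ` e) ` edges G \<union> (\<lambda>e. Inr ` e) ` edges H \<union>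
     {{Inl u, Inr v} | u v. u \<in> verts G \<and> v \<in> verts H})"

text \<open>The index counts all vertices, including the hub.\<close>

definition wheel_graph :: "nat \<Rightarrow> (nat + nat) graph" where
  "wheel_graph n = graph_join (complete_graph 1) (cycle_graph (n - 1))"

text \<open>A copy is a subgraph, not necessarily induced, so non-edges are unconstrained.\<close>

definition is_copy :: "('a \<Rightarrow> 'b) \<Rightarrow> 'a graph \<Rightarrow> 'b graph \<Rightarrow> bool" where
  "is_copy \<phi> H G \<longleftrightarrow>
    inj_on \<phi> (verts H) \<and> \<phi> ` verts H \<subseteq> verts G \<and> (\<forall>e \<in> edges H. \<phi> ` e \<in> edges G)"

definition has_rainbow_copy :: "('b set \<Rightarrow> nat) \<Rightarrow> 'a graph \<Rightarrow> 'b graph \<Rightarrow> bool" where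
  "has_rainbow_copy c H G \<longleftrightarrow>
    (\<exists>\<phi>. is_copy \<phi> H G \<and> inj_on (\<lambda>e. c (\<phi> ` e)) (edges H))"

definition has_mono_copy :: "('b set \<Rightarrow> nat) \<Rightarrow> 'a graph \<Rightarrow> 'b graph \<Rightarrow> bool" where
  "has_mono_copy c H G \<longleftrightarrow>
    (\<exists>\<phi> i. is_copy \<phi> H G \<and> (\<forall>e \<in> edges H. c (\<phi> ` e) = i))"

text \<open>
  The colors are \<open>0, \<dots>, k - 1\<close>; a coloring need not use all of them,
  which expresses the use of at most \<open>k\<close> colors.
\<close>

definition gallai_ramsey :: "nat \<Rightarrow> 'a graph \<Rightarrow> 'b graph \<Rightarrow> nat" where
  "gallai_ramsey k G H =
    (LEAST m. \<forall>c \<in> edges (complete_graph m) \<rightarrow> {..<k}.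
       has_rainbow_copy c G (complete_graph m) \<or> has_mono_copy c H (complete_graph m))"

end

theory Submission
  imports Defs
begin

text \<open>
  Upper bound: a color joining one part of the vertices to the rest can only form a matching (or, if
  one side is a single vertex, avoid the 4-cycle) inside the parts. So one bounds, by induction on
  the number of vertices, Gallai colorings in which every color avoids the wheel or avoids the
  4-cycle, apart from colors that together form a matching. If the vertices split into two parts
  with a single color in between, both parts are smaller instances. Otherwise Gallai's theorem gives
  a partition with two colors between the parts. If all parts are singletons, this is the Ramsey
  bound \<open>R(W\<^sub>5, W\<^sub>5) \<le> 15\<close>; if not, a largest part and its neighborhoods in the two colors
  consist of at most five smaller instances, up to a few vertices.

  Lower bound: start with a circulant coloring on 14 vertices, substitute it into the two-colored
  \<open>K\<^sub>5\<close> without a monochromatic triangle to gain two colors, or double it to gain one.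
\<close>

section \<open>Forbidden subgraphs\<close>

text \<open>The quantity bounded by induction is \<open>card V + card C\<close>, where
  \<open>F\<close> and \<open>C\<close> are the wheel-free and the 4-cycle-free colors. The obstacle
  is a single vertex joined to all others in one color: it does not eliminate this color, it only
  makes it 4-cycle-free on the rest. The summand \<open>card C\<close> charges exactly one vertex
  for that. Matching colors are not counted at all: the wheel is K5 minus two disjoint edges, so a
  matching does not enlarge the bound for one wheel-free color, and since rainbow triangles are
  excluded, matchings that arise one after the other still form one matching. The initial values are
  2 (a single matching edge), 4 (one less than the order of the wheel), 14 (Ramsey) and 28 (two
  copies of 14). From then on two further colors give exactly a factor 5: from above a largest part
  counts once and each of its two neighborhoods twice, from below there are five copies.\<close>

definition p3_free :: "('a \<Rightarrow> 'a \<Rightarrow> bool) \<Rightarrow> 'a set \<Rightarrow> bool" where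
  "p3_free r V \<longleftrightarrow> (\<forall>a\<in>V. \<forall>b\<in>V. \<forall>c\<in>V. distinct [a, b, c] \<longrightarrow> \<not> (r a b \<and> r b c))"

definition c4_free :: "('a \<Rightarrow> 'a \<Rightarrow> bool) \<Rightarrow> 'a set \<Rightarrow> bool" where
  "c4_free r V \<longleftrightarrow> (\<forall>a\<in>V. \<forall>b\<in>V. \<forall>c\<in>V. \<forall>d\<in>V. distinct [a, b, c, d] \<longrightarrow>
     \<not> (r a b \<and> r b c \<and> r c d \<and> r d a))"

definition w5_free :: "('a \<Rightarrow> 'a \<Rightarrow> bool) \<Rightarrow> 'a set \<Rightarrow> bool" where
  "w5_free r V \<longleftrightarrow> (\<forall>h\<in>V. \<forall>a\<in>V. \<forall>b\<in>V. \<forall>c\<in>V. \<forall>d\<in>V. distinct [h, a, b, c, d] \<longrightarrow>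
     \<not> (r h a \<and> r h b \<and> r h c \<and> r h d \<and> r a b \<and> r b c \<and> r c d \<and> r d a))"

lemma p3_free_subset: "p3_free r V \<Longrightarrow> U \<subseteq> V \<Longrightarrow> p3_free r U"
  unfolding p3_free_def by blast

lemma c4_free_subset: "c4_free r V \<Longrightarrow> U \<subseteq> V \<Longrightarrow> c4_free r U"
  unfolding c4_free_def by blast

lemma w5_free_subset: "w5_free r V \<Longrightarrow> U \<subseteq> V \<Longrightarrow> w5_free r U"
  unfolding w5_free_def by blast

lemma c4_free_imp_w5_free: "c4_free r V \<Longrightarrow> w5_free r V"
  unfolding c4_free_def w5_free_def by (metis distinct_length_2_or_more)

lemma extend_distinct_list:
  assumes "finite X" "distinct xs" "set xs \<subseteq> X"
  obtains ys where "distinct (xs @ ys)" "set (xs @ ys) = X" "length xs + length ys = card X"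
proof -
  obtain ys where ys: "set ys = X - set xs" "distinct ys"
    using finite_distinct_list[of "X - set xs"] assms(1) by auto
  have d: "distinct (xs @ ys)" "set (xs @ ys) = X" using ys assms by auto
  then have "length xs + length ys = card X" using distinct_card by fastforce
  with d that show thesis by blast
qed

section \<open>Two-colored complete graphs without a monochromatic wheel\<close>

fun k_sublists :: "nat \<Rightarrow> 'a list \<Rightarrow> 'a list list" where
  "k_sublists 0 xs = [[]]"
| "k_sublists (Suc k) [] = []"
| "k_sublists (Suc k) (x # xs) = map ((#) x) (k_sublists k xs) @ k_sublists (Suc k) xs"

fun no_claw :: "('a \<Rightarrow> 'a \<Rightarrow> bool) \<Rightarrow> 'a list \<Rightarrow> bool" where
  "no_claw r [a, b, c, d] \<longleftrightarrow>
     \<not> (r a b \<and> r a c \<and> r a d) \<and> \<not> (r a b \<and> r b c \<and> r b d) \<and>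
     \<not> (r a c \<and> r b c \<and> r c d) \<and> \<not> (r a d \<and> r b d \<and> r c d)"
| "no_claw r _ \<longleftrightarrow> True"

fun no_p3 :: "('a \<Rightarrow> 'a \<Rightarrow> bool) \<Rightarrow> 'a list \<Rightarrow> bool" where
  "no_p3 r [a, b, c] \<longleftrightarrow> \<not> (r a b \<and> r b c) \<and> \<not> (r a b \<and> r a c) \<and> \<not> (r a c \<and> r b c)"
| "no_p3 r _ \<longleftrightarrow> True"

fun no_c4 :: "('a \<Rightarrow> 'a \<Rightarrow> bool) \<Rightarrow> 'a list \<Rightarrow> bool" where
  "no_c4 r [a, b, c, d] \<longleftrightarrow>
     \<not> (r a b \<and> r b c \<and> r c d \<and> r a d) \<and>
     \<not> (r a b \<and> r b d \<and> r c d \<and> r a c) \<and>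
     \<not> (r a c \<and> r b c \<and> r b d \<and> r a d)"
| "no_c4 r _ \<longleftrightarrow> True"

text \<open>A wheel on five vertices is a choice of the hub and of one of the three 4-cycles on the
  other vertices, so these five lines cover all 15 wheels.\<close>

fun no_w5 :: "('a \<Rightarrow> 'a \<Rightarrow> bool) \<Rightarrow> 'a list \<Rightarrow> bool" where
  "no_w5 r [h, a, b, c, d] \<longleftrightarrow>
     (r h a \<and> r h b \<and> r h c \<and> r h d \<longrightarrow> no_c4 r [a, b, c, d]) \<and>
     (r h a \<and> r a b \<and> r a c \<and> r a d \<longrightarrow> no_c4 r [h, b, c, d]) \<and>
     (r h b \<and> r a b \<and> r b c \<and> r b d \<longrightarrow> no_c4 r [h, a, c, d]) \<and>
     (r h c \<and> r a c \<and> r b c \<and> r c d \<longrightarrow> no_c4 r [h, a, b, d]) \<and>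
     (r h d \<and> r a d \<and> r b d \<and> r c d \<longrightarrow> no_c4 r [h, a, b, c])"
| "no_w5 r _ \<longleftrightarrow> True"

text \<open>
  A graph property of a vertex list unfolds to finitely many propositional clauses over the atoms
  \<open>r x y\<close>, where \<open>x\<close> precedes \<open>y\<close> in the list; the \<open>sat\<close> method then does the case analysis.
\<close>

lemma k_sublistsD:
  "ys \<in> set (k_sublists k xs) \<Longrightarrow>
    set ys \<subseteq> set xs \<and> (distinct xs \<longrightarrow> distinct ys) \<and> length ys = k"
  by (induction k xs arbitrary: ys rule: k_sublists.induct) (auto, blast+)

lemma k_sublists_3E:
  assumes "ys \<in> set (k_sublists 3 xs)" "distinct xs"
  obtains a b c where "ys = [a, b, c]" "distinct [a, b, c]" "{a, b, c} \<subseteq> set xs"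
  using k_sublistsD[OF assms(1)] assms(2)
  by (auto simp: length_Suc_conv numeral_eq_Suc)

lemma k_sublists_4E:
  assumes "ys \<in> set (k_sublists 4 xs)" "distinct xs"
  obtains a b c d where "ys = [a, b, c, d]" "distinct [a, b, c, d]" "{a, b, c, d} \<subseteq> set xs"
  using k_sublistsD[OF assms(1)] assms(2)
  by (auto simp: length_Suc_conv numeral_eq_Suc)

lemma k_sublists_5E:
  assumes "ys \<in> set (k_sublists 5 xs)" "distinct xs"
  obtains h a b c d where "ys = [h, a, b, c, d]" "distinct [h, a, b, c, d]"
    "{h, a, b, c, d} \<subseteq> set xs"
  using k_sublistsD[OF assms(1)] assms(2)
  by (auto simp: length_Suc_conv numeral_eq_Suc)

lemma p3_free_clauses:
  assumes "p3_free r V" "\<And>x y. r x y = r y x" "distinct xs" "set xs \<subseteq> V"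
  shows "\<forall>ys \<in> set (k_sublists 3 xs). no_p3 r ys"
proof
  fix ys assume "ys \<in> set (k_sublists 3 xs)"
  then obtain a b c where ys: "ys = [a, b, c]" "distinct [a, b, c]" "{a, b, c} \<subseteq> V"
    by (rule k_sublists_3E[OF _ assms(3)]) (use assms(4) in blast)
  show "no_p3 r ys" using ys(2,3) assms(1)[unfolded p3_free_def] unfolding ys(1)
    by (simp add: assms(2)) (metis assms(2))
qed

lemma no_c4I:
  assumes "c4_free r V" "\<And>x y. r x y = r y x" "distinct [a, b, c, d]" "{a, b, c, d} \<subseteq> V"
  shows "no_c4 r [a, b, c, d]"
  using assms(1)[unfolded c4_free_def] assms(3,4)
  by (simp add: assms(2)) (metis assms(2))

lemma c4_free_clauses:
  assumes "c4_free r V" "\<And>x y. r x y = r y x" "distinct xs" "set xs \<subseteq> V"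
  shows "\<forall>ys \<in> set (k_sublists 4 xs). no_c4 r ys"
proof
  fix ys assume "ys \<in> set (k_sublists 4 xs)"
  then obtain a b c d where "ys = [a, b, c, d]" "distinct [a, b, c, d]" "{a, b, c, d} \<subseteq> V"
    by (rule k_sublists_4E[OF _ assms(3)]) (use assms(4) in blast)
  then show "no_c4 r ys" using no_c4I[OF assms(1,2)] by metis
qed

text \<open>A 4-cycle among the neighbors would be the rim of a wheel with hub
  \<open>v\<close>.\<close>

lemma c4_free_neighbors:
  assumes "w5_free r V" "v \<in> V" "B \<subseteq> V - {v}" "\<And>x. x \<in> B \<Longrightarrow> r v x"
  shows "c4_free r B"
  unfolding c4_free_def
proof (intro ballI impI)
  fix a b c d assume B: "a \<in> B" "b \<in> B" "c \<in> B" "d \<in> B" "distinct [a, b, c, d]"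
  have "distinct [v, a, b, c, d]" "a \<in> V" "b \<in> V" "c \<in> V" "d \<in> V" using B assms(3) by auto
  then show "\<not> (r a b \<and> r b c \<and> r c d \<and> r d a)"
    using assms(1,2,4) B(1-4) unfolding w5_free_def by blast
qed

lemma w5_free_clauses:
  assumes "w5_free r V" "\<And>x y. r x y = r y x" "distinct xs" "set xs \<subseteq> V"
  shows "\<forall>ys \<in> set (k_sublists 5 xs). no_w5 r ys"
proof
  fix ys assume "ys \<in> set (k_sublists 5 xs)"
  then obtain h a b c d where ys: "ys = [h, a, b, c, d]" and d: "distinct [h, a, b, c, d]"
    and sub: "{h, a, b, c, d} \<subseteq> V"
    by (rule k_sublists_5E[OF _ assms(3)]) (use assms(4) in blast)
  have *: "no_c4 r [a, b, c, d]"
    if "distinct [h, a, b, c, d]" "{h, a, b, c, d} \<subseteq> V" "r h a" "r h b" "r h c" "r h d"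
    for h a b c d
  proof -
    have "c4_free r {a, b, c, d}"
      by (rule c4_free_neighbors[OF assms(1), of h]) (use that in auto)
    then show ?thesis by (rule no_c4I) (use assms(2) that(1) in auto)
  qed
  show "no_w5 r ys"
    using *[of h a b c d] *[of a h b c d] *[of b h a c d] *[of c h a b d] *[of d h a b c] d sub
    unfolding ys by (auto simp: assms(2))
qed

section \<open>Red graphs without a 4-cycle and without a blue wheel\<close>

lemma claw_in_8:
  assumes C: "c4_free r X" and W: "w5_free (\<lambda>x y. \<not> r x y) X"
    and sym: "\<And>x y. r x y = r y x" and "card X = 8"
  obtains x a b c where "distinct [x, a, b, c]" "{x, a, b, c} \<subseteq> X" "r x a" "r x b" "r x c"
proof (rule ccontr)
  assume neg: "\<not> thesis"
  have "finite X" using \<open>card X = 8\<close> card.infinite by fastforce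
  then obtain xs where "distinct xs" "set xs = X" "length xs = 8"
    using extend_distinct_list[of X "[]"] \<open>card X = 8\<close> by auto
  then obtain x a b c p q s t where d: "distinct [x, a, b, c, p, q, s, t]"
    and X: "X = {x, a, b, c, p, q, s, t}"
    by (auto simp: length_Suc_conv numeral_eq_Suc)
  \<comment> \<open>Without a claw all red degrees are at most 2, and such a sparse red graph leaves
    room for a blue wheel.\<close>
  have cl: "\<forall>ys\<in>set (k_sublists 4 [x, a, b, c, p, q, s, t]). no_claw r ys"
  proof
    fix ys assume "ys \<in> set (k_sublists 4 [x, a, b, c, p, q, s, t])"
    then obtain x' a' b' c' where ys: "ys = [x', a', b', c']" "distinct [x', a', b', c']"
      "{x', a', b', c'} \<subseteq> X"
      using d by (rule k_sublists_4E) (auto simp: X)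
    show "no_claw r ys"
      using neg that[of x' a' b' c'] that[of a' x' b' c'] that[of b' x' a' c'] that[of c' x' a' b']
        ys(2,3) unfolding ys(1) by (auto simp: sym)
  qed
  show False
    using cl c4_free_clauses[OF C sym d] w5_free_clauses[OF W _ d] sym
    unfolding X
    apply (simp add: numeral_eq_Suc del: no_c4.simps no_w5.simps no_claw.simps)
    unfolding no_c4.simps no_w5.simps no_claw.simps
    by sat
qed

text \<open>
  The triangular prism with two subdivided rungs: triangles \<open>t0 t1 t2\<close> and \<open>n0 p q\<close>, the rung
  \<open>t0 n0\<close> and the subdivided rungs \<open>t1 n1 p\<close> and \<open>t2 n2 q\<close>. Up to isomorphism it is the only red
  graph on 8 vertices without a red 4-cycle and a blue wheel.
\<close>

definition subdivided_prism ::
  "('a \<Rightarrow> 'a \<Rightarrow> bool) \<Rightarrow> 'a \<Rightarrow> 'a \<Rightarrow> 'a \<Rightarrow> 'a \<Rightarrow> 'a \<Rightarrow> 'a \<Rightarrow> 'a \<Rightarrow> 'a \<Rightarrow> bool" where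
  "subdivided_prism r t0 t1 t2 n0 n1 n2 p q \<longleftrightarrow>
     r t0 t1 \<and> r t0 t2 \<and> r t1 t2 \<and> r t0 n0 \<and> r t1 n1 \<and> r t2 n2 \<and>
     r n0 p \<and> r n0 q \<and> r p q \<and> r n1 p \<and> r n2 q"

text \<open>Each stage fixes a piece of the picture before the next propositional search: a claw, an
  edge between two of its leaves, the outer neighbors of the resulting triangle, and finally the
  last two vertices.\<close>

lemma eight_vertices:
  assumes C: "c4_free r X" and W: "w5_free (\<lambda>x y. \<not> r x y) X"
    and sym: "\<And>x y. r x y = r y x" and X8: "card X = 8"
  obtains t0 t1 t2 n0 n1 n2 p q where "distinct [t0, t1, t2, n0, n1, n2, p, q]"
    "X = {t0, t1, t2, n0, n1, n2, p, q}" "subdivided_prism r t0 t1 t2 n0 n1 n2 p q"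
proof -
  have fin: "finite X" using X8 card.infinite by fastforce
  have clauses: "(\<forall>ys\<in>set (k_sublists 4 xs). no_c4 r ys) \<and>
     (\<forall>ys\<in>set (k_sublists 5 xs). no_w5 (\<lambda>x y. \<not> r x y) ys)"
    if "distinct xs" "set xs = X" for xs
    using c4_free_clauses[OF C sym that(1)] w5_free_clauses[OF W _ that(1)] sym that(2) by simp
  have rest4: "\<exists>p q s t. distinct [x, a, b, c, p, q, s, t] \<and> set [x, a, b, c, p, q, s, t] = X"
    if xs: "distinct [x, a, b, c]" "{x, a, b, c} \<subseteq> X" for x a b c
  proof -
    obtain ys where ys: "distinct ([x, a, b, c] @ ys)" "set ([x, a, b, c] @ ys) = X"
      "length ys = 4"
      using extend_distinct_list[OF fin xs(1)] xs(2) X8 by auto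
    from ys(3) obtain p q s t where "ys = [p, q, s, t]"
      by (auto simp: length_Suc_conv numeral_eq_Suc)
    then show ?thesis using ys(1,2) by (metis append_Cons append_Nil)
  qed
  have "\<exists>x a b c. distinct [x, a, b, c] \<and> {x, a, b, c} \<subseteq> X \<and> r x a \<and> r x b \<and> r x c \<and> r a b"
  proof -
    obtain x a b c where x: "distinct [x, a, b, c]" "{x, a, b, c} \<subseteq> X" "r x a" "r x b" "r x c"
      using claw_in_8[OF assms] .
    then obtain p q s t where d: "distinct [x, a, b, c, p, q, s, t]"
      "set [x, a, b, c, p, q, s, t] = X" using rest4 by metis
    have "r a b \<or> r a c \<or> r b c"
      using clauses[OF d] x(3-)
      apply (simp add: numeral_eq_Suc del: no_c4.simps no_w5.simps)
      unfolding no_c4.simps no_w5.simps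
      by sat
    then show ?thesis
    proof (elim disjE)
      assume "r a b"
      with x show ?thesis by (intro exI[of _ x] exI[of _ a] exI[of _ b] exI[of _ c]) simp
    next
      assume "r a c"
      with x show ?thesis by (intro exI[of _ x] exI[of _ a] exI[of _ c] exI[of _ b]) auto
    next
      assume "r b c"
      with x show ?thesis by (intro exI[of _ x] exI[of _ b] exI[of _ c] exI[of _ a]) auto
    qed
  qed
  then obtain x a b c where x: "distinct [x, a, b, c]" "{x, a, b, c} \<subseteq> X"
    "r x a" "r x b" "r x c" "r a b" by blast
  then obtain p q s t where d: "distinct [x, a, b, c, p, q, s, t]"
    "set [x, a, b, c, p, q, s, t] = X" using rest4 by metis
  \<comment> \<open>Unless \<open>a\<close> and \<open>b\<close> have red neighbors outside the
    claw, there is a blue wheel. They cannot share one, as it would close a red 4-cycle with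
    \<open>x\<close>.\<close>
  have "(r a p \<or> r a q \<or> r a s \<or> r a t) \<and> (r b p \<or> r b q \<or> r b s \<or> r b t) \<and>
    \<not> (r a p \<and> r b p) \<and> \<not> (r a q \<and> r b q) \<and> \<not> (r a s \<and> r b s) \<and> \<not> (r a t \<and> r b t)"
    using clauses[OF d] x(3-)
    apply (simp add: numeral_eq_Suc del: no_c4.simps no_w5.simps)
    unfolding no_c4.simps no_w5.simps
    by sat
  then obtain n1 n2 where n: "n1 \<in> {p, q, s, t}" "n2 \<in> {p, q, s, t}" "n1 \<noteq> n2" "r a n1" "r b n2"
    by blast
  have "distinct [x, a, b, c, n1, n2]" "set [x, a, b, c, n1, n2] \<subseteq> X"
    using d n by auto
  then obtain ys where ys: "distinct ([x, a, b, c, n1, n2] @ ys)"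
    "set ([x, a, b, c, n1, n2] @ ys) = X" "length ys = 2"
    using extend_distinct_list[OF fin, of "[x, a, b, c, n1, n2]"] X8 by auto
  from ys(3) obtain k l where "ys = [k, l]"
    by (auto simp: length_Suc_conv numeral_eq_Suc)
  then have e: "distinct [x, a, b, c, n1, n2, k, l]" "set [x, a, b, c, n1, n2, k, l] = X"
    using ys(1,2) by simp_all
  \<comment> \<open>One of the vertices \<open>c\<close>, \<open>n1\<close>, \<open>n2\<close>
    attached to the triangle \<open>x a b\<close> is adjacent to both \<open>k\<close> and
    \<open>l\<close>, the other two to one each. Three choices of \<open>t0\<close> and two orders
    of \<open>p\<close> and \<open>q\<close> give the six cases.\<close>
  have kl: "r k l" and "r c k \<and> r c l \<and> (r n1 k \<and> r n2 l \<or> r n1 l \<and> r n2 k) \<or>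
     r n1 k \<and> r n1 l \<and> (r c k \<and> r n2 l \<or> r c l \<and> r n2 k) \<or>
     r n2 k \<and> r n2 l \<and> (r c k \<and> r n1 l \<or> r c l \<and> r n1 k)"
    using clauses[OF e] x(3-) n(4,5)
    by (simp_all add: numeral_eq_Suc del: no_c4.simps no_w5.simps, unfold no_c4.simps no_w5.simps)
      sat+
  then consider
      "subdivided_prism r x a b c n1 n2 k l" | "subdivided_prism r x a b c n1 n2 l k"
    | "subdivided_prism r a x b n1 c n2 k l" | "subdivided_prism r a x b n1 c n2 l k"
    | "subdivided_prism r b x a n2 c n1 k l" | "subdivided_prism r b x a n2 c n1 l k"
    unfolding subdivided_prism_def using x n by (auto simp: sym)
  then show thesis
  proof cases
    case 1 show thesis by (rule that[OF _ _ 1]) (use e(1) in \<open>auto simp: e(2)[symmetric] insert_commute\<close>)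
  next
    case 2 show thesis by (rule that[OF _ _ 2]) (use e(1) in \<open>auto simp: e(2)[symmetric] insert_commute\<close>)
  next
    case 3 show thesis by (rule that[OF _ _ 3]) (use e(1) in \<open>auto simp: e(2)[symmetric] insert_commute\<close>)
  next
    case 4 show thesis by (rule that[OF _ _ 4]) (use e(1) in \<open>auto simp: e(2)[symmetric] insert_commute\<close>)
  next
    case 5 show thesis by (rule that[OF _ _ 5]) (use e(1) in \<open>auto simp: e(2)[symmetric] insert_commute\<close>)
  next
    case 6 show thesis by (rule that[OF _ _ 6]) (use e(1) in \<open>auto simp: e(2)[symmetric] insert_commute\<close>)
  qed
qed

text \<open>This is R(C4, W5) \<le> 9: eight of nine vertices would carry the subdivided prism, and
  there is no way to attach a ninth vertex to it.\<close>

lemma nine_vertices: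
  assumes C: "c4_free r X" and W: "w5_free (\<lambda>x y. \<not> r x y) X"
    and sym: "\<And>x y. r x y = r y x" and "finite X"
  shows "card X \<le> 8"
proof (rule ccontr)
  assume "\<not> card X \<le> 8"
  then obtain Y where Y: "Y \<subseteq> X" "card Y = 8" by (metis nat_le_linear obtain_subset_with_card_n)
  have "Y \<noteq> X" using Y \<open>\<not> card X \<le> 8\<close> by auto
  then obtain z where z: "z \<in> X" "z \<notin> Y" using Y by blast
  obtain t0 t1 t2 n0 n1 n2 p q where d: "distinct [t0, t1, t2, n0, n1, n2, p, q]"
    and Y': "Y = {t0, t1, t2, n0, n1, n2, p, q}"
    and S: "subdivided_prism r t0 t1 t2 n0 n1 n2 p q"
    using eight_vertices[OF c4_free_subset[OF C Y(1)] w5_free_subset[OF W Y(1)] sym Y(2)] .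
  have e: "distinct [t0, t1, t2, n0, n1, n2, p, q, z]" "set [t0, t1, t2, n0, n1, n2, p, q, z] \<subseteq> X"
    using d z Y Y' by auto
  show False
    using c4_free_clauses[OF C sym e] w5_free_clauses[OF W _ e] sym S[unfolded subdivided_prism_def]
    apply (simp add: numeral_eq_Suc del: no_c4.simps no_w5.simps)
    unfolding no_c4.simps no_w5.simps
    by sat
qed

section \<open>The Ramsey bound R(W5, W5) \<le> 15\<close>

lemma even_card_symmetric:
  assumes "finite V" and sym: "\<And>x y. r x y = r y x"
  shows "even (\<Sum>v\<in>V. card {x \<in> V - {v}. r v x})"
  using assms(1)
proof induction
  case (insert w V)
  have *: "card {x \<in> insert w V - {v}. r v x} = card {x \<in> V - {v}. r v x} + (if r w v then 1 else 0)"
    if "v \<in> V" for v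
  proof (cases "r w v")
    case True
    have "{x \<in> insert w V - {v}. r v x} = insert w {x \<in> V - {v}. r v x}"
      using that insert.hyps True sym by auto
    then show ?thesis using insert.hyps True by simp
  next
    case False
    then have "{x \<in> insert w V - {v}. r v x} = {x \<in> V - {v}. r v x}"
      using sym by auto
    then show ?thesis using False by simp
  qed
  have "(\<Sum>v\<in>insert w V. card {x \<in> insert w V - {v}. r v x}) =
    card {x \<in> V. r w x} + (\<Sum>v\<in>V. card {x \<in> V - {v}. r v x} + (if r w v then 1 else 0))"
  proof -
    have w: "{x \<in> insert w V - {w}. r w x} = {x \<in> V. r w x}" using insert.hyps by auto
    have "(\<Sum>v\<in>V. card {x \<in> insert w V - {v}. r v x}) =
      (\<Sum>v\<in>V. card {x \<in> V - {v}. r v x} + (if r w v then 1 else 0))"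
      by (rule sum.cong[OF refl]) (rule *)
    then show ?thesis
      unfolding sum.insert[OF insert.hyps] w by (rule arg_cong)
  qed
  \<comment> \<open>Handshaking: each edge at \<open>w\<close> counts once at \<open>w\<close> and
    once at its other end.\<close>
  also have "\<dots> = 2 * card {x \<in> V. r w x} + (\<Sum>v\<in>V. card {x \<in> V - {v}. r v x})"
    using insert.hyps by (simp add: sum.distrib sum.If_cases Int_def)
  finally show ?case using insert.IH by simp
qed simp

text \<open>
  A vertex \<open>y\<close> outside the red neighborhood of \<open>v\<close> sees a prism around \<open>v\<close> in a red matching and a
  blue graph without 4-cycles. This leaves six possibilities, each of them covered by one of four
  blue paths, and two such vertices cannot share a blue path.
\<close>

lemma no_red_degree_8:
  assumes W: "w5_free r V" and W': "w5_free (\<lambda>x y. \<not> r x y) V"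
    and sym: "\<And>x y. r x y = r y x" and fin: "finite V" and v: "v \<in> V"
    and 8: "card {x \<in> V - {v}. r v x} = 8"
  shows "card {x \<in> V - {v}. \<not> r v x} \<le> 4"
proof -
  define X where "X = {x \<in> V - {v}. r v x}"
  define Y where "Y = {x \<in> V - {v}. \<not> r v x}"
  have XV: "X \<subseteq> V" "v \<notin> X" unfolding X_def by auto
  have C: "c4_free r X" by (rule c4_free_neighbors[OF W v]) (auto simp: X_def)
  obtain t0 t1 t2 n0 n1 n2 p q where d: "distinct [t0, t1, t2, n0, n1, n2, p, q]"
    and X: "X = {t0, t1, t2, n0, n1, n2, p, q}"
    and S: "subdivided_prism r t0 t1 t2 n0 n1 n2 p q"
    using eight_vertices[OF C w5_free_subset[OF W' XV(1)] sym 8[folded X_def]] .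
  have dX: "set [t0, t1, t2, n0, n1, n2, p, q] \<subseteq> X" using X by simp
  \<comment> \<open>Each of these six pairs would close a red 4-cycle with three edges of the
    prism.\<close>
  have blue: "\<not> r t0 p \<and> \<not> r t2 p \<and> \<not> r t0 q \<and> \<not> r t1 q \<and> \<not> r t2 n1 \<and> \<not> r t1 n2"
    using c4_free_clauses[OF C sym d dX] S[unfolded subdivided_prism_def]
    apply (simp add: numeral_eq_Suc del: no_c4.simps)
    unfolding no_c4.simps
    by sat
  \<comment> \<open>By \<open>blue\<close>, every triple is a blue path with its second entry in the
    middle.\<close>
  define path where "path = (\<lambda>i::nat. [(t0, p, t2), (t0, q, t1), (n1, t2, p), (n2, t1, q)] ! i)"
  have "\<exists>i<4. case path i of (a, b, c) \<Rightarrow> \<not> r y a \<and> \<not> r y b \<and> \<not> r y c" if "y \<in> Y" for y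
  proof -
    have y: "y \<in> V" "y \<noteq> v" "\<not> r v y" "y \<notin> X" using that unfolding X_def Y_def by auto
    \<comment> \<open>A red path \<open>a b c\<close> in the common red neighborhood of
      \<open>v\<close> and \<open>y\<close> gives a red wheel with hub \<open>b\<close> and rim
      \<open>v a y c\<close>.\<close>
    have P: "p3_free (\<lambda>a b. r a b \<and> r y a \<and> r y b) X"
      unfolding p3_free_def
    proof (intro ballI impI notI)
      fix a b c assume abc: "a \<in> X" "b \<in> X" "c \<in> X" "distinct [a, b, c]"
        "(r a b \<and> r y a \<and> r y b) \<and> (r b c \<and> r y b \<and> r y c)"
      have "distinct [b, v, a, y, c]" using abc y XV by auto
      moreover have "r v a" "r v b" "r v c" using abc unfolding X_def by auto
      ultimately show False
        using W v y(1) abc(1-3,5) XV(1) sym unfolding w5_free_def by (metis subsetD)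
    qed
    have Q: "c4_free (\<lambda>a b. \<not> r a b \<and> \<not> r y a \<and> \<not> r y b) X"
      unfolding c4_free_def
    proof (intro ballI impI notI)
      fix a b c d assume abc: "a \<in> X" "b \<in> X" "c \<in> X" "d \<in> X" "distinct [a, b, c, d]"
        "(\<not> r a b \<and> \<not> r y a \<and> \<not> r y b) \<and> (\<not> r b c \<and> \<not> r y b \<and> \<not> r y c) \<and>
         (\<not> r c d \<and> \<not> r y c \<and> \<not> r y d) \<and> (\<not> r d a \<and> \<not> r y d \<and> \<not> r y a)"
      have "distinct [y, a, b, c, d]" using abc y by auto
      then show False
        using W' y(1) abc XV(1) unfolding w5_free_def by (metis subsetD)
    qed
    have "\<forall>ys\<in>set (k_sublists 3 [t0, t1, t2, n0, n1, n2, p, q]).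
        no_p3 (\<lambda>a b. r a b \<and> r y a \<and> r y b) ys"
      by (rule p3_free_clauses[OF P _ d dX]) (use sym in auto)
    moreover have "\<forall>ys\<in>set (k_sublists 4 [t0, t1, t2, n0, n1, n2, p, q]).
        no_c4 (\<lambda>a b. \<not> r a b \<and> \<not> r y a \<and> \<not> r y b) ys"
      by (rule c4_free_clauses[OF Q _ d dX]) (use sym in auto)
    moreover note c4_free_clauses[OF C sym d dX] S[unfolded subdivided_prism_def]
    ultimately have "\<not> r y t0 \<and> \<not> r y p \<and> \<not> r y t2 \<or> \<not> r y t0 \<and> \<not> r y q \<and> \<not> r y t1 \<or>
      \<not> r y n1 \<and> \<not> r y t2 \<and> \<not> r y p \<or> \<not> r y n2 \<and> \<not> r y t1 \<and> \<not> r y q"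
      apply (simp add: numeral_eq_Suc del: no_c4.simps no_p3.simps)
      unfolding no_c4.simps no_p3.simps
      by sat
    then show ?thesis
    proof (elim disjE)
      assume "\<not> r y t0 \<and> \<not> r y p \<and> \<not> r y t2"
      then show ?thesis by (intro exI[of _ 0]) (simp add: path_def)
    next
      assume "\<not> r y t0 \<and> \<not> r y q \<and> \<not> r y t1"
      then show ?thesis by (intro exI[of _ 1]) (simp add: path_def)
    next
      assume "\<not> r y n1 \<and> \<not> r y t2 \<and> \<not> r y p"
      then show ?thesis by (intro exI[of _ 2]) (simp add: path_def)
    next
      assume "\<not> r y n2 \<and> \<not> r y t1 \<and> \<not> r y q"
      then show ?thesis by (intro exI[of _ 3]) (simp add: path_def numeral_eq_Suc)
    qed
  qed
  then obtain f where f: "\<And>y. y \<in> Y \<Longrightarrow> f y < 4 \<and>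
      (case path (f y) of (a, b, c) \<Rightarrow> \<not> r y a \<and> \<not> r y b \<and> \<not> r y c)"
    by metis
  \<comment> \<open>Two vertices \<open>y\<close>, \<open>z\<close> that are blue to the same path
    \<open>a b c\<close> give a blue wheel with hub \<open>b\<close> and rim
    \<open>a y c z\<close>.\<close>
  have "inj_on f Y"
  proof (rule inj_onI, rule ccontr)
    fix y z assume yz: "y \<in> Y" "z \<in> Y" "f y = f z" "y \<noteq> z"
    obtain a b c where p: "path (f y) = (a, b, c)" by (cases "path (f y)")
    have abc: "{a, b, c} \<subseteq> X" "distinct [a, b, c]" "\<not> r a b" "\<not> r b c"
      using p f[OF yz(1)] d blue sym unfolding path_def X
      by (auto simp: numeral_eq_Suc less_Suc_eq)
    have "distinct [b, a, y, c, z]" using abc yz unfolding X_def Y_def by auto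
    moreover have "\<not> r y a" "\<not> r y b" "\<not> r y c" "\<not> r z a" "\<not> r z b" "\<not> r z c"
      using f[OF yz(1)] f[OF yz(2)] p yz(3) by auto
    moreover have "a \<in> V" "b \<in> V" "c \<in> V" "y \<in> V" "z \<in> V"
      using abc yz unfolding X_def Y_def by auto
    ultimately show False
      using W' abc(3,4) sym unfolding w5_free_def by metis
  qed
  moreover have "f ` Y \<subseteq> {..<4}" using f by auto
  ultimately have "card Y \<le> 4" using card_inj_on_le[of f Y "{..<4}"] by simp
  then show ?thesis unfolding Y_def .
qed

text \<open>The red and blue degrees of a vertex add up to 14 and are at most 8 by
  \<open>nine_vertices\<close>. Degree 8 in one color leaves at most 4 in the other, so all degrees
  are 7, but 15 vertices of degree 7 violate parity.\<close>

lemma fifteen_vertices: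
  assumes W: "w5_free r V" and W': "w5_free (\<lambda>x y. \<not> r x y) V"
    and sym: "\<And>x y. r x y = r y x" and fin: "finite V"
  shows "card V \<le> 14"
proof (rule ccontr)
  assume "\<not> card V \<le> 14"
  then obtain U where U: "U \<subseteq> V" "card U = 15" using obtain_subset_with_card_n[of 15 V] by auto
  have fU: "finite U" using U fin finite_subset by blast
  note W = w5_free_subset[OF W U(1)] and W' = w5_free_subset[OF W' U(1)]
  have W'': "w5_free (\<lambda>x y. \<not> \<not> r x y) U" using W by simp
  define R where "R = (\<lambda>v. {x \<in> U - {v}. r v x})"
  define B where "B = (\<lambda>v. {x \<in> U - {v}. \<not> r v x})"
  have 7: "card (R v) = 7" if v: "v \<in> U" for v
  proof -
    have "card (R v) + card (B v) = card (U - {v})"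
      unfolding R_def B_def using fU by (subst card_Un_disjoint[symmetric]) (auto intro: arg_cong[of _ _ card])
    then have sum: "card (R v) + card (B v) = 14" using v U(2) fU by simp
    have sub: "R v \<subseteq> U - {v}" "B v \<subseteq> U - {v}" unfolding R_def B_def by auto
    have "c4_free r (R v)" by (rule c4_free_neighbors[OF W v sub(1)]) (simp add: R_def)
    then have "card (R v) \<le> 8"
      using nine_vertices[OF _ w5_free_subset[OF W'] sym, of "R v"] sub fU
      by (meson Diff_subset finite_subset subset_trans)
    moreover have "c4_free (\<lambda>x y. \<not> r x y) (B v)"
      by (rule c4_free_neighbors[OF W' v sub(2)]) (simp add: B_def)
    then have "card (B v) \<le> 8"
      using nine_vertices[OF _ w5_free_subset[OF W''], of "B v"] sub fU sym
      by (meson Diff_subset finite_subset subset_trans)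
    moreover have "card (R v) \<noteq> 8"
      using no_red_degree_8[OF W W' sym fU v] sum unfolding R_def B_def by linarith
    moreover have "card (B v) = 8 \<Longrightarrow> card {x \<in> U - {v}. \<not> \<not> r v x} \<le> 4"
      unfolding B_def using sym by (intro no_red_degree_8[OF W' W'' _ fU v]) blast+
    then have "card (B v) \<noteq> 8" using sum unfolding R_def by auto
    ultimately show ?thesis using sum by linarith
  qed
  have "even (\<Sum>v\<in>U. card (R v))"
    unfolding R_def by (rule even_card_symmetric[OF fU sym])
  then show False using 7 U(2) by simp
qed

section \<open>Gallai colorings\<close>

definition gallai :: "('a \<Rightarrow> 'a \<Rightarrow> nat) \<Rightarrow> 'a set \<Rightarrow> bool" where
  "gallai d V \<longleftrightarrow> (\<forall>x\<in>V. \<forall>y\<in>V. \<forall>z\<in>V. distinct [x, y, z] \<longrightarrow>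
     d x y = d y z \<or> d x y = d x z \<or> d y z = d x z)"

definition mono_split :: "('a \<Rightarrow> 'a \<Rightarrow> nat) \<Rightarrow> 'a set \<Rightarrow> bool" where
  "mono_split d V \<longleftrightarrow> (\<exists>A B i. A \<noteq> {} \<and> B \<noteq> {} \<and> A \<inter> B = {} \<and> A \<union> B = V \<and>
     (\<forall>a\<in>A. \<forall>b\<in>B. d a b = i))"

lemma mono_splitI:
  assumes "A \<noteq> {}" "B \<noteq> {}" "A \<inter> B = {}" "A \<union> B = V" "\<And>a b. a \<in> A \<Longrightarrow> b \<in> B \<Longrightarrow> d a b = i"
  shows "mono_split d V"
  unfolding mono_split_def by (intro exI[of _ A] exI[of _ B] exI[of _ i] conjI ballI assms)

section \<open>Components of a single color\<close>

definition color_edges :: "('a \<Rightarrow> 'a \<Rightarrow> nat) \<Rightarrow> nat \<Rightarrow> 'a set \<Rightarrow> ('a \<times> 'a) set" where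
  "color_edges d i V = {(x, y). x \<in> V \<and> y \<in> V \<and> x \<noteq> y \<and> d x y = i}"

definition color_connected :: "('a \<Rightarrow> 'a \<Rightarrow> nat) \<Rightarrow> nat \<Rightarrow> 'a set \<Rightarrow> bool" where
  "color_connected d i V \<longleftrightarrow> (\<forall>x\<in>V. \<forall>y\<in>V. (x, y) \<in> (color_edges d i V)\<^sup>*)"

lemma gallai_subset: "gallai d V \<Longrightarrow> U \<subseteq> V \<Longrightarrow> gallai d U"
  unfolding gallai_def by blast

lemma gallaiD:
  "gallai d V \<Longrightarrow> x \<in> V \<Longrightarrow> y \<in> V \<Longrightarrow> z \<in> V \<Longrightarrow> x \<noteq> y \<Longrightarrow> x \<noteq> z \<Longrightarrow> y \<noteq> z \<Longrightarrow>
    d x y = d y z \<or> d x y = d x z \<or> d y z = d x z"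
  unfolding gallai_def by simp

lemma color_edges_rtrancl_sym:
  assumes "\<And>x y. d x y = d y x"
  shows "sym ((color_edges d i V)\<^sup>*)"
  by (rule sym_rtrancl) (auto simp: sym_def color_edges_def assms)

lemma color_edges_rtrancl_in: "(x, y) \<in> (color_edges d i V)\<^sup>* \<Longrightarrow> x \<in> V \<Longrightarrow> y \<in> V"
  by (induction rule: rtrancl_induct) (auto simp: color_edges_def)

text \<open>An edge \<open>u w\<close> of color \<open>i\<close> in the component and the outside
  vertex \<open>y\<close> span a triangle in which neither edge at \<open>y\<close> has color
  \<open>i\<close>, so these two edges agree. This propagates along the component.\<close>

lemma color_component_homogeneous:
  assumes G: "gallai d V" and sym: "\<And>x y. d x y = d y x"
    and "x \<in> V" "y \<in> V" "(x, y) \<notin> (color_edges d i V)\<^sup>*"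
    and "(x, x') \<in> (color_edges d i V)\<^sup>*"
  shows "d y x' = d y x"
  using assms(6)
proof (induction rule: rtrancl_induct)
  case (step u w)
  have u: "u \<in> V" using step.hyps(1) assms(3) by (rule color_edges_rtrancl_in)
  have w: "w \<in> V" "u \<noteq> w" "d u w = i" using step.hyps(2) by (auto simp: color_edges_def)
  have xw: "(x, w) \<in> (color_edges d i V)\<^sup>*" using step.hyps by (rule rtrancl_into_rtrancl)
  have "y \<noteq> u" "y \<noteq> w" using assms(5) step.hyps(1) xw by auto
  moreover have "d y u \<noteq> i" "d y w \<noteq> i"
    using assms(4,5) step.hyps(1) xw u w \<open>y \<noteq> u\<close> \<open>y \<noteq> w\<close> sym
    by (auto simp: color_edges_def intro: rtrancl_into_rtrancl)
  ultimately have "d y u = d y w"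
    using gallaiD[OF G, of y u w] assms(4) u w by auto
  then show ?case using step.IH by simp
qed simp

text \<open>
  The classical argument for Gallai's lemma: if color \<open>i\<close> becomes disconnected after removing \<open>v\<close>,
  then \<open>v\<close> sends an edge of color \<open>i\<close> to every component, so an edge from \<open>v\<close> of another color \<open>j\<close>
  into a component forces all edges leaving this component to have color \<open>j\<close>.
\<close>

lemma color_connected_neighbor:
  assumes conn: "color_connected d i (insert v W)" and "v \<notin> W" "x \<in> W"
  obtains y where "(x, y) \<in> (color_edges d i W)\<^sup>*" "y \<in> W" "d y v = i"
proof -
  have "(x, u) \<in> (color_edges d i W)\<^sup>* \<or> (\<exists>y. (x, y) \<in> (color_edges d i W)\<^sup>* \<and> d y v = i)"
    if "(x, u) \<in> (color_edges d i (insert v W))\<^sup>*" for u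
    using that
  proof (induction rule: rtrancl_induct)
    case (step u w)
    show ?case
    proof (cases "(x, u) \<in> (color_edges d i W)\<^sup>*")
      case True
      then have "u \<in> W" using assms(3) color_edges_rtrancl_in by metis
      show ?thesis
      proof (cases "w = v")
        case True
        then show ?thesis
          using step.hyps(2) \<open>(x, u) \<in> (color_edges d i W)\<^sup>*\<close> by (auto simp: color_edges_def)
      next
        case False
        then have "(u, w) \<in> color_edges d i W"
          using step.hyps(2) \<open>u \<in> W\<close> by (auto simp: color_edges_def)
        then show ?thesis using True by (meson rtrancl_into_rtrancl)
      qed
    next
      case False
      then show ?thesis using step.IH by blast
    qed
  qed simp
  moreover have "(x, v) \<in> (color_edges d i (insert v W))\<^sup>*"
    using conn assms(3) unfolding color_connected_def by blast
  moreover have "(x, v) \<notin> (color_edges d i W)\<^sup>*"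
    using assms(2,3) color_edges_rtrancl_in by metis
  ultimately obtain y where "(x, y) \<in> (color_edges d i W)\<^sup>*" "d y v = i" by blast
  then show thesis using that assms(3) color_edges_rtrancl_in by metis
qed

lemma color_connected_delete:
  assumes G: "gallai d (insert v W)" and sym: "\<And>x y. d x y = d y x" and v: "v \<notin> W" "W \<noteq> {}"
    and ijk: "i \<noteq> j" "i \<noteq> k" "j \<noteq> k"
    and conn: "color_connected d i (insert v W)" "color_connected d j (insert v W)"
      "color_connected d k (insert v W)"
  shows "color_connected d i W"
proof (rule ccontr)
  assume "\<not> color_connected d i W"
  then obtain u w where uw: "u \<in> W" "w \<in> W" "(u, w) \<notin> (color_edges d i W)\<^sup>*"
    unfolding color_connected_def by blast
  define E where "E = (color_edges d i W)\<^sup>*"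
  have Esym: "(a, b) \<in> E \<Longrightarrow> (b, a) \<in> E" for a b
    unfolding E_def using color_edges_rtrancl_sym[where d = d, OF sym] by (meson symE)
  have Etrans: "(a, b) \<in> E \<Longrightarrow> (b, c) \<in> E \<Longrightarrow> (a, c) \<in> E" for a b c
    unfolding E_def by (rule rtrancl_trans)
  have GW: "gallai d W" using G by (rule gallai_subset) auto
  \<comment> \<open>Homogeneity applied at both ends: any two different components are joined in a
    single color.\<close>
  have hom: "d a b = d a' b'"
    if "a \<in> W" "b \<in> W" "(a, b) \<notin> E" "(a, a') \<in> E" "(b, b') \<in> E" for a b a' b'
  proof -
    have a': "a' \<in> W" using that unfolding E_def by (metis color_edges_rtrancl_in)
    have "d b a' = d b a"
      using color_component_homogeneous[OF GW sym that(1,2)] that(3,4) unfolding E_def by blast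
    moreover have "(b, a') \<notin> E" using Etrans[OF that(4) Esym] that(3) by blast
    then have "d a' b' = d a' b"
      using color_component_homogeneous[OF GW sym that(2) a'] that(5) unfolding E_def by blast
    ultimately show ?thesis using sym by metis
  qed
  have force: "d a b = l" if ab: "a \<in> W" "b \<in> W" "(a, b) \<notin> E" "d a v = l" "l \<noteq> i" for a b l
  proof -
    obtain b' where b': "(b, b') \<in> E" "b' \<in> W" "d b' v = i"
      using color_connected_neighbor[OF conn(1) v(1) ab(2)] unfolding E_def .
    have ab': "(a, b') \<notin> E" using Etrans[OF _ Esym[OF b'(1)]] ab(3) by blast
    then have "a \<noteq> b'" unfolding E_def by auto
    then have "d a b' \<noteq> i"
      using ab' ab(1) b'(2) unfolding E_def color_edges_def by auto
    moreover have "d a b' = d b' v \<or> d a b' = d a v \<or> d b' v = d a v"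
      using gallaiD[OF G, of a b' v] ab b' v \<open>a \<noteq> b'\<close> by auto
    ultimately have "d a b' = l" using ab b' by auto
    moreover have "(a, a) \<in> E" unfolding E_def by simp
    ultimately show ?thesis using hom[OF ab(1-3) _ b'(1)] by metis
  qed
  obtain x where x: "x \<in> W" "d x v = j"
    using color_connected_neighbor[OF conn(2) v(1) uw(1)] by metis
  obtain z where z: "z \<in> W" "d z v = k"
    using color_connected_neighbor[OF conn(3) v(1) uw(1)] by metis
  \<comment> \<open>If \<open>x\<close> and \<open>z\<close> lie in different components, the edge
    between them is forced to have both colors \<open>j\<close> and \<open>k\<close>. If they share
    a component, the same clash occurs on their edges to a vertex of another component.\<close>
  show False
  proof (cases "(x, z) \<in> E")
    case False
    then have "(z, x) \<notin> E" using Esym by blast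
    then have "d x z = j" "d z x = k"
      using force[OF x(1) z(1) False x(2)] force[OF z(1) x(1) _ z(2)] ijk by simp_all
    then show False using sym[of x z] ijk by simp
  next
    case True
    obtain y where y: "y \<in> W" "(x, y) \<notin> E"
      using uw Etrans[OF Esym, of x u w] unfolding E_def[symmetric] by metis
    have "(z, y) \<notin> E" using Etrans[OF True] y(2) by blast
    then have "d x y = j" "d z y = k"
      using force[OF x(1) y(1,2) x(2)] force[OF z(1) y(1) _ z(2)] ijk by simp_all
    moreover have "d x y = d z y"
      using hom[OF x(1) y(1) y(2) True, of y] unfolding E_def by simp
    ultimately show False using ijk by simp
  qed
qed

text \<open>Deleting vertices one by one keeps all three colors connected, down to a single edge,
  which cannot have two colors.\<close>

lemma not_three_connected_colors:
  assumes "finite V" "gallai d V" and sym: "\<And>x y. d x y = d y x"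
    and "card V \<ge> 2" "i \<noteq> j" "i \<noteq> k" "j \<noteq> k"
    and "color_connected d i V" "color_connected d j V" "color_connected d k V"
  shows False
  using assms(1,2,4,8-)
proof (induction V)
  case (insert v W)
  from insert.prems(2) insert.hyps have "W \<noteq> {}" by auto
  have conn: "color_connected d i W" "color_connected d j W" "color_connected d k W"
    using color_connected_delete[OF insert.prems(1) sym insert.hyps(2) \<open>W \<noteq> {}\<close>] assms(5-7)
      insert.prems(3-5) by metis+
  have GW: "gallai d W" using insert.prems(1) by (rule gallai_subset) auto
  show False
  proof (cases "card W \<ge> 2")
    case True
    then show False using insert.IH[OF GW _ conn] by simp
  next
    case False
    then have "card W = 1" using \<open>W \<noteq> {}\<close> insert.hyps(1) by (simp add: Suc_leI card_gt_0_iff le_antisym not_less_eq_eq)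
    then obtain w where w: "W = {w}" by (auto simp: card_1_singleton_iff)
    then have "d w v = i" "d w v = j"
      using color_connected_neighbor[OF insert.prems(3) insert.hyps(2), of w]
        color_connected_neighbor[OF insert.prems(4) insert.hyps(2), of w] by auto
    then show False using assms(5) by simp
  qed
qed simp

text \<open>
  A retraction \<open>p\<close> encodes a Gallai partition: its fibers are the parts, and \<open>p x\<close> is the chosen
  representative of the part of \<open>x\<close>.
\<close>

definition gallai_retraction :: "('a \<Rightarrow> 'a \<Rightarrow> nat) \<Rightarrow> 'a set \<Rightarrow> ('a \<Rightarrow> 'a) \<Rightarrow> nat \<Rightarrow> nat \<Rightarrow> bool" where
  "gallai_retraction d V p r b \<longleftrightarrow> r \<noteq> b \<and>
     (\<forall>x\<in>V. p x \<in> V \<and> p (p x) = p x) \<and> (\<exists>x\<in>V. \<exists>y\<in>V. p x \<noteq> p y) \<and>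
     (\<forall>x\<in>V. \<forall>y\<in>V. p x \<noteq> p y \<longrightarrow> d x y = d (p x) (p y) \<and> (d x y = r \<or> d x y = b))"

text \<open>If the color of some edge does not connect \<open>V\<close>, its component containing
  this edge looks the same to each outside vertex; it is contracted to one vertex, and induction
  applies. Otherwise all occurring colors connect \<open>V\<close>, so there are at most two, and
  every vertex is a part of its own.\<close>

lemma gallai_retraction_exists:
  assumes "finite V" "gallai d V" and sym: "\<And>x y. d x y = d y x"
    and "\<not> mono_split d V" "card V \<ge> 2"
  shows "\<exists>p r b. gallai_retraction d V p r b"
  using assms(1,2,4,5)
proof (induction "card V" arbitrary: V rule: less_induct)
  case less
  note fin = less.prems(1) and G = less.prems(2) and nosplit = less.prems(3)
  show ?case
  proof (cases "\<exists>x\<in>V. \<exists>y\<in>V. x \<noteq> y \<and> \<not> color_connected d (d x y) V")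
    case True
    then obtain x y where xy: "x \<in> V" "y \<in> V" "x \<noteq> y" "\<not> color_connected d (d x y) V" by blast
    define i where "i = d x y"
    define K where "K = {z. (x, z) \<in> (color_edges d i V)\<^sup>*}"
    have KV: "K \<subseteq> V" unfolding K_def using xy(1) color_edges_rtrancl_in by fastforce
    have xK: "x \<in> K" unfolding K_def by simp
    have yK: "y \<in> K" unfolding K_def i_def color_edges_def using xy by auto
    have hom: "d z c = d z x" if "c \<in> K" "z \<in> V - K" for z c
      using color_component_homogeneous[OF G sym xy(1), of z i c] that unfolding K_def by simp
    have "K \<noteq> V"
    proof
      assume "K = V"
      then have "(x, z) \<in> (color_edges d i V)\<^sup>*" if "z \<in> V" for z using that K_def by blast
      then have "color_connected d i V"
        unfolding color_connected_def
        using color_edges_rtrancl_sym[where d = d, OF sym] by (meson rtrancl_trans symE)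
      then show False using xy(4) i_def by simp
    qed
    then obtain z where z: "z \<in> V" "z \<notin> K" using KV by blast
    define W where "W = insert x (V - K)"
    have WV: "W \<subseteq> V" unfolding W_def using xy(1) by auto
    have "y \<notin> W" unfolding W_def using yK xy(3) by auto
    then have smaller: "card W < card V" using WV xy(2) fin by (metis psubsetI psubset_card_mono)
    have finW: "finite W" using WV fin finite_subset by blast
    have "{x, z} \<subseteq> W" "x \<noteq> z" unfolding W_def using z xK by auto
    then have card2: "card W \<ge> 2" using card_mono[OF finW, of "{x, z}"] by simp
    \<comment> \<open>A one-color split of \<open>W\<close> lifts to \<open>V\<close>, with all of
      \<open>K\<close> on the side of \<open>x\<close>.\<close>
    have "\<not> mono_split d W"
    proof
      assume "mono_split d W"
      then obtain A B j where AB: "A \<noteq> {}" "B \<noteq> {}" "A \<inter> B = {}" "A \<union> B = W"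
        "\<forall>a\<in>A. \<forall>b\<in>B. d a b = j"
        unfolding mono_split_def by blast
      have sp: False if AB: "A \<noteq> {}" "B \<noteq> {}" "A \<inter> B = {}" "A \<union> B = W" "\<forall>a\<in>A. \<forall>b\<in>B. d a b = j"
        and "x \<in> A" for A B
      proof -
        have "\<forall>a\<in>A \<union> K. \<forall>b\<in>B. d a b = j"
        proof (intro ballI)
          fix a b assume a: "a \<in> A \<union> K" and b: "b \<in> B"
          have "b \<in> V - K" using b AB(3,4) \<open>x \<in> A\<close> unfolding W_def by auto
          then show "d a b = j" using a b AB(5) \<open>x \<in> A\<close> hom sym by (metis UnE)
        qed
        moreover have "(A \<union> K) \<inter> B = {}" using AB(3,4) \<open>x \<in> A\<close> unfolding W_def by auto
        moreover have "(A \<union> K) \<union> B = V" using AB(4) KV WV unfolding W_def by auto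
        ultimately have "mono_split d V"
          unfolding mono_split_def using AB(1,2) by (intro exI[of _ "A \<union> K"] exI[of _ B]) auto
        then show False using nosplit by simp
      qed
      have "x \<in> A \<or> x \<in> B" using AB(4) unfolding W_def by auto
      then show False
        using sp[of A B] sp[of B A] AB sym by (metis Int_commute Un_commute)
    qed
    from less.hyps[OF smaller finW gallai_subset[OF G WV] this card2]
    obtain p r b where p: "gallai_retraction d W p r b" by blast
    define f where "f = (\<lambda>u. if u \<in> K then x else u)"
    have f: "f u \<in> W" if "u \<in> V" for u using that unfolding f_def W_def by auto
    have fW: "f u = u" if "u \<in> W" for u using that xK unfolding f_def W_def by auto
    have df: "d u w = d (f u) (f w)" if "u \<in> V" "w \<in> V" "f u \<noteq> f w" for u w
      using that hom[of u w] hom[of w u] sym unfolding f_def by (auto split: if_splits) (metis+)?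
    have "gallai_retraction d V (\<lambda>u. p (f u)) r b"
      unfolding gallai_retraction_def
    proof (intro conjI ballI impI)
      show "r \<noteq> b" using p unfolding gallai_retraction_def by simp
    next
      fix u assume "u \<in> V"
      then have "p (f u) \<in> W" "p (p (f u)) = p (f u)"
        using p f unfolding gallai_retraction_def by auto
      then show "p (f u) \<in> V" "p (f (p (f u))) = p (f u)" using fW WV by auto
    next
      show "\<exists>x\<in>V. \<exists>y\<in>V. p (f x) \<noteq> p (f y)"
        using p fW WV unfolding gallai_retraction_def by (metis subsetD)
    next
      fix u w assume uw: "u \<in> V" "w \<in> V" "p (f u) \<noteq> p (f w)"
      then have "f u \<noteq> f w" by auto
      have "p (f u) \<in> W" "p (f w) \<in> W"
        using p f uw unfolding gallai_retraction_def by auto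
      have *: "d (f u) (f w) = d (p (f u)) (p (f w)) \<and> (d (f u) (f w) = r \<or> d (f u) (f w) = b)"
        using p f uw unfolding gallai_retraction_def by blast
      then show "d u w = d (p (f u)) (p (f w))" "d u w = r \<or> d u w = b"
        using df[OF uw(1,2) \<open>f u \<noteq> f w\<close>] by auto
    qed
    then show ?thesis by blast
  next
    case False
    obtain x y where xy: "x \<in> V" "y \<in> V" "x \<noteq> y"
      using less.prems(4) by (metis card_le_Suc0_iff_eq fin not_less_eq_eq numeral_2_eq_2)
    define r where "r = d x y"
    obtain b where b: "r \<noteq> b" "\<forall>u\<in>V. \<forall>w\<in>V. u \<noteq> w \<longrightarrow> d u w = r \<or> d u w = b"
    proof (cases "\<exists>u\<in>V. \<exists>w\<in>V. u \<noteq> w \<and> d u w \<noteq> r")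
      case True
      then obtain u w where uw: "u \<in> V" "w \<in> V" "u \<noteq> w" "d u w \<noteq> r" by blast
      have "d s t = r \<or> d s t = d u w" if "s \<in> V" "t \<in> V" "s \<noteq> t" for s t
      proof (rule ccontr)
        assume "\<not> (d s t = r \<or> d s t = d u w)"
        then show False
          using not_three_connected_colors[OF fin G sym less.prems(4), of r "d u w" "d s t"]
            False that uw xy unfolding r_def by metis
      qed
      then show thesis using that[of "d u w"] uw by blast
    next
      case False
      \<comment> \<open>Only \<open>r\<close> occurs here; any different number can stand for the
        second color.\<close>
      then show thesis using that[of "Suc r"] by auto
    qed
    have "gallai_retraction d V id r b"
      unfolding gallai_retraction_def using b xy by auto
    then show ?thesis by blast
  qed
qed

lemma gallai_retraction_commute: "gallai_retraction d V p r b \<Longrightarrow> gallai_retraction d V p b r"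
  unfolding gallai_retraction_def by blast

section \<open>The upper bound\<close>

text \<open>The recursion starts as late as four colors because 5 * 2 < 14 and 5 * 4 < 28.\<close>

fun gr_bound :: "nat \<Rightarrow> nat" where
  "gr_bound 0 = 2"
| "gr_bound (Suc 0) = 4"
| "gr_bound (Suc (Suc 0)) = 14"
| "gr_bound (Suc (Suc (Suc 0))) = 28"
| "gr_bound (Suc (Suc (Suc (Suc n)))) = 5 * gr_bound (Suc (Suc n))"

lemma gr_bound_Suc: "2 * gr_bound k \<le> gr_bound (Suc k)"
  by (induction k rule: gr_bound.induct) auto

lemma gr_bound_Suc_Suc: "5 * gr_bound k \<le> gr_bound (Suc (Suc k))"
  by (induction k rule: gr_bound.induct) auto

lemma gr_bound_linear: "k + 2 \<le> gr_bound k"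
proof (induction k)
  case (Suc k)
  then show ?case using gr_bound_Suc[of k] by linarith
qed simp

text \<open>Equality holds for two colors. If two colors lie in \<open>F\<close>, then
  \<open>card C\<close> \<le> \<open>k - 2\<close>, so this is what turns \<open>card V\<close>
  \<le> 14 into the bound on \<open>card V + card C\<close>.\<close>

lemma gr_bound_ge_12: "k + 12 \<le> gr_bound k" if "k \<ge> 2"
  using that
proof (induction k rule: dec_induct)
  case (step k)
  then show ?case using gr_bound_Suc[of k] by linarith
qed (simp add: numeral_eq_Suc)

text \<open>
  Colors in \<open>F\<close> avoid the wheel, colors in \<open>C\<close> avoid the 4-cycle, and all other colors together
  form a matching. Joining a part of the vertex set to the rest in one color moves this color from
  \<open>F\<close> to \<open>C\<close>, or from \<open>F\<close> or \<open>C\<close> to the matching colors, inside the parts.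
\<close>

definition admissible :: "('a \<Rightarrow> 'a \<Rightarrow> nat) \<Rightarrow> nat set \<Rightarrow> nat set \<Rightarrow> 'a set \<Rightarrow> bool" where
  "admissible d F C V \<longleftrightarrow> finite V \<and> finite F \<and> finite C \<and> F \<inter> C = {} \<and> gallai d V \<and>
     (\<forall>i\<in>F. w5_free (\<lambda>x y. d x y = i) V) \<and> (\<forall>i\<in>C. c4_free (\<lambda>x y. d x y = i) V) \<and>
     p3_free (\<lambda>x y. d x y \<notin> F \<union> C) V"

lemma admissible_w5_free:
  "admissible d F C V \<Longrightarrow> i \<in> F \<union> C \<Longrightarrow> w5_free (\<lambda>x y. d x y = i) V"
  unfolding admissible_def by (auto intro: c4_free_imp_w5_free)

lemma admissible_demote:
  assumes "admissible d F C V" "U \<subseteq> V" "i \<in> F" "c4_free (\<lambda>x y. d x y = i) U"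
  shows "admissible d (F - {i}) (insert i C) U"
proof -
  have "F - {i} \<union> insert i C = F \<union> C" using assms(3) by auto
  then show ?thesis
    using assms unfolding admissible_def
    by (auto intro: finite_subset gallai_subset w5_free_subset c4_free_subset p3_free_subset)
qed

lemma card_ge_2E:
  assumes "card A \<ge> 2"
  obtains a b where "a \<in> A" "b \<in> A" "a \<noteq> b"
  using assms by (metis card_2_iff' card_le_Suc0_iff_eq card.infinite not_less_eq_eq numeral_2_eq_2 zero_le)

lemma p3_free_neighbors:
  assumes "c4_free r V" "\<And>x y. r x y = r y x" "v \<in> V" "B \<subseteq> V - {v}" "\<And>x. x \<in> B \<Longrightarrow> r v x"
  shows "p3_free r B"
  unfolding p3_free_def
proof (intro ballI impI)
  fix a b c assume B: "a \<in> B" "b \<in> B" "c \<in> B" "distinct [a, b, c]"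
  have "distinct [v, a, b, c]" "a \<in> V" "b \<in> V" "c \<in> V" using B assms(4) by auto
  then show "\<not> (r a b \<and> r b c)"
    using assms(1,2,3,5) B(1-3) unfolding c4_free_def by blast
qed

text \<open>A matching has at most two edges on five vertices, and K5 minus two disjoint edges is
  the wheel itself.\<close>

lemma card_le_4:
  assumes "finite V" "w5_free r V" "p3_free (\<lambda>x y. \<not> r x y) V" "\<And>x y. r x y = r y x"
  shows "card V \<le> 4"
proof (rule ccontr)
  assume "\<not> card V \<le> 4"
  then obtain U where U: "U \<subseteq> V" "card U = 5" using obtain_subset_with_card_n[of 5 V] by auto
  then have "finite U" using assms(1) finite_subset by blast
  then obtain xs where xs: "distinct xs" "set xs = U" "length xs = 5"
    using extend_distinct_list[of U "[]"] U(2) by auto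
  then obtain a b c e f where "xs = [a, b, c, e, f]"
    by (auto simp: length_Suc_conv numeral_eq_Suc)
  then have d: "distinct [a, b, c, e, f]" and sub: "set [a, b, c, e, f] \<subseteq> V" using xs U by auto
  show False
    using w5_free_clauses[OF assms(2,4) d sub] p3_free_clauses[OF assms(3) _ d sub] assms(4)
    apply (simp add: numeral_eq_Suc del: no_c4.simps no_w5.simps no_p3.simps)
    unfolding no_c4.simps no_w5.simps no_p3.simps
    by sat
qed

section \<open>Joins in one color\<close>

context
  fixes d :: "'a \<Rightarrow> 'a \<Rightarrow> nat"
  assumes sym: "\<And>x y. d x y = d y x"
begin

text \<open>The new matching color and the old ones form one matching: if an edge \<open>x y\<close>
  of color \<open>i\<close> met an edge \<open>y z\<close> of an old matching color, then
  \<open>x z\<close> could have neither color \<open>i\<close> nor an old matching color, and the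
  triangle would be rainbow.\<close>

lemma admissible_matching:
  assumes adm: "admissible d F C V" and U: "U \<subseteq> V" and i: "p3_free (\<lambda>x y. d x y = i) U"
  shows "admissible d (F - {i}) (C - {i}) U"
proof -
  have G: "gallai d U" using adm U gallai_subset unfolding admissible_def by blast
  have M: "p3_free (\<lambda>x y. d x y \<notin> F \<union> C) U"
    using adm U p3_free_subset unfolding admissible_def by blast
  have mixed: False if xyz: "x \<in> U" "y \<in> U" "z \<in> U" "distinct [x, y, z]" "d x y = i" "d y z \<notin> F \<union> C"
    and "i \<in> F \<union> C" for x y z
  proof -
    have "d x z \<noteq> i" using i xyz sym unfolding p3_free_def by (metis distinct_length_2_or_more)
    moreover have "d x z \<in> F \<union> C"
      using M xyz sym unfolding p3_free_def by (metis distinct_length_2_or_more)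
    ultimately show False
      using gallaiD[OF G, of x y z] xyz \<open>i \<in> F \<union> C\<close> by auto
  qed
  have "p3_free (\<lambda>x y. d x y \<notin> F - {i} \<union> (C - {i})) U"
    unfolding p3_free_def
  proof (intro ballI impI notI)
    fix x y z assume xyz: "x \<in> U" "y \<in> U" "z \<in> U" "distinct [x, y, z]"
      "d x y \<notin> F - {i} \<union> (C - {i}) \<and> d y z \<notin> F - {i} \<union> (C - {i})"
    then have "d x y = i \<or> d x y \<notin> F \<union> C" "d y z = i \<or> d y z \<notin> F \<union> C" by auto
    moreover have "\<not> (d x y = i \<and> d y z = i)" using i xyz unfolding p3_free_def by blast
    moreover have "\<not> (d x y \<notin> F \<union> C \<and> d y z \<notin> F \<union> C)" using M xyz unfolding p3_free_def by blast
    ultimately consider "d x y = i" "d y z \<notin> F \<union> C" "i \<in> F \<union> C"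
      | "d y z = i" "d x y \<notin> F \<union> C" "i \<in> F \<union> C" by blast
    then show False
    proof cases
      case 1 then show False using mixed[of x y z] xyz by blast
    next
      case 2 then show False using mixed[of z y x] xyz sym by auto
    qed
  qed
  then show ?thesis
    using adm U unfolding admissible_def
    by (auto intro: finite_subset gallai_subset w5_free_subset c4_free_subset)
qed

text \<open>A path \<open>x y z\<close> of color \<open>i\<close> in \<open>B\<close> and two
  vertices \<open>a\<close>, \<open>a'\<close> of \<open>A\<close> form a wheel with hub
  \<open>y\<close> and rim \<open>x a z a'\<close>.\<close>

lemma join_matching:
  assumes "w5_free (\<lambda>x y. d x y = i) V" "A \<subseteq> V" "B \<subseteq> V" "A \<inter> B = {}" "card A \<ge> 2"
    and "\<And>a x. a \<in> A \<Longrightarrow> x \<in> B \<Longrightarrow> d a x = i"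
  shows "p3_free (\<lambda>x y. d x y = i) B"
  unfolding p3_free_def
proof (intro ballI impI notI)
  obtain a a' where a: "a \<in> A" "a' \<in> A" "a \<noteq> a'" using assms(5) by (rule card_ge_2E)
  fix x y z assume xyz: "x \<in> B" "y \<in> B" "z \<in> B" "distinct [x, y, z]" "d x y = i \<and> d y z = i"
  have "distinct [y, x, a, z, a']" using a xyz assms(4) by auto
  moreover have "a \<in> V" "a' \<in> V" "x \<in> V" "y \<in> V" "z \<in> V" using a xyz assms by auto
  moreover have "d a x = i" "d a y = i" "d a z = i" "d a' x = i" "d a' y = i" "d a' z = i"
    using a xyz assms(6) by auto
  ultimately show False
    using assms(1) xyz(5) sym unfolding w5_free_def by metis
qed

lemma join_c4_free:
  assumes "c4_free (\<lambda>x y. d x y = i) V" "A \<subseteq> V" "B \<subseteq> V" "A \<inter> B = {}" "card A \<ge> 2"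
    and "\<And>a x. a \<in> A \<Longrightarrow> x \<in> B \<Longrightarrow> d a x = i"
  shows "card B \<le> 1"
proof (rule ccontr)
  assume "\<not> card B \<le> 1"
  then have "card B \<ge> 2" by simp
  then obtain x y where x: "x \<in> B" "y \<in> B" "x \<noteq> y" by (rule card_ge_2E)
  obtain a a' where a: "a \<in> A" "a' \<in> A" "a \<noteq> a'" using assms(5) by (rule card_ge_2E)
  have "distinct [a, x, a', y]" using a x assms(4) by auto
  moreover have "d a x = i" "d a y = i" "d a' x = i" "d a' y = i" using a x assms(6) by auto
  ultimately show False
    using assms(1-3) a x sym unfolding c4_free_def by (metis subsetD)
qed

text \<open>Without \<open>v\<close>, a color \<open>i\<close> of \<open>F\<close> moves to
  \<open>C\<close>: one vertex is lost and \<open>card C\<close> grows by one, so the inequality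
  carries over unchanged. A color \<open>i\<close> of \<open>C\<close> becomes a matching color, and
  the doubling of \<open>gr_bound\<close> covers the loss.\<close>

lemma bound_singleton:
  assumes adm: "admissible d F C V"
    and IH: "\<And>U F C. U \<subset> V \<Longrightarrow> admissible d F C U \<Longrightarrow> card U + card C \<le> gr_bound (card F + card C)"
    and V: "V = insert v B" "v \<notin> B" "\<And>x. x \<in> B \<Longrightarrow> d v x = i" and i: "i \<in> F \<union> C"
  shows "card V + card C \<le> gr_bound (card F + card C)"
proof -
  have fin: "finite V" "finite F" "finite C" "F \<inter> C = {}" using adm unfolding admissible_def by auto
  have BV: "B \<subset> V" "B \<subseteq> V - {v}" "v \<in> V" using V by auto
  have cardV: "card V = Suc (card B)" using V fin by simp
  show ?thesis
  proof (cases "i \<in> C")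
    case True
    then have "c4_free (\<lambda>x y. d x y = i) V" using adm unfolding admissible_def by blast
    then have "p3_free (\<lambda>x y. d x y = i) B"
      by (rule p3_free_neighbors[OF _ _ BV(3,2)]) (use sym V(3) in auto)
    from IH[OF BV(1) admissible_matching[OF adm _ this]] BV
    have "card B + card (C - {i}) \<le> gr_bound (card (F - {i}) + card (C - {i}))" by blast
    moreover have "F - {i} = F" using True fin by auto
    moreover have C: "Suc (card (C - {i})) = card C" by (rule card_Suc_Diff1[OF fin(3) True])
    ultimately have "card B + card (C - {i}) \<le> gr_bound (card F + card (C - {i}))"
      and K: "card F + card C = Suc (card F + card (C - {i}))" by simp_all
    then show ?thesis
      using gr_bound_Suc[of "card F + card (C - {i})"] gr_bound_linear[of "card F + card (C - {i})"]
        cardV C unfolding K by linarith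
  next
    case False
    then have iF: "i \<in> F" using i by simp
    then have "w5_free (\<lambda>x y. d x y = i) V" using adm unfolding admissible_def by blast
    then have "c4_free (\<lambda>x y. d x y = i) B"
      by (rule c4_free_neighbors[OF _ BV(3,2)]) (use V(3) in auto)
    from IH[OF BV(1) admissible_demote[OF adm _ iF this]] BV
    have "card B + card (insert i C) \<le> gr_bound (card (F - {i}) + card (insert i C))" by blast
    moreover have "Suc (card (F - {i})) = card F" by (rule card_Suc_Diff1[OF fin(2) iF])
    ultimately show ?thesis using False fin cardV by (metis add_Suc add_Suc_right card_insert_disjoint)
  qed
qed

text \<open>If both sides have at least two vertices, \<open>i\<close> is a matching inside each of
  them, so both are instances with one color less. A matching color \<open>i\<close> forces both
  sides to be single vertices.\<close>

lemma bound_mono_split: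
  assumes adm: "admissible d F C V"
    and IH: "\<And>U F C. U \<subset> V \<Longrightarrow> admissible d F C U \<Longrightarrow> card U + card C \<le> gr_bound (card F + card C)"
    and "mono_split d V"
  shows "card V + card C \<le> gr_bound (card F + card C)"
proof -
  have fin: "finite V" "finite F" "finite C" "F \<inter> C = {}" using adm unfolding admissible_def by auto
  obtain A B i where AB: "A \<noteq> {}" "B \<noteq> {}" "A \<inter> B = {}" "A \<union> B = V"
    and "\<forall>a\<in>A. \<forall>b\<in>B. d a b = i"
    using assms(3) unfolding mono_split_def by blast
  then have i: "\<And>a b. a \<in> A \<Longrightarrow> b \<in> B \<Longrightarrow> d a b = i" and i': "\<And>b a. b \<in> B \<Longrightarrow> a \<in> A \<Longrightarrow> d b a = i"
    using sym by metis+
  have sub: "A \<subset> V" "B \<subset> V" "A \<subseteq> V" "B \<subseteq> V" using AB by auto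
  have finAB: "finite A" "finite B" using sub(3,4) fin(1) by (simp_all add: finite_subset)
  have cardV: "card V = card A + card B" using AB finAB card_Un_disjoint by blast
  have pos: "card A > 0" "card B > 0" using AB finAB by (simp_all add: card_gt_0_iff)
  show ?thesis
  proof (cases "i \<in> F \<union> C")
    case False
    have M: "p3_free (\<lambda>x y. d x y \<notin> F \<union> C) V" using adm unfolding admissible_def by blast
    have "card A \<le> 1"
    proof (rule ccontr)
      assume "\<not> card A \<le> 1"
      then obtain a a' where "a \<in> A" "a' \<in> A" "a \<noteq> a'" using card_ge_2E[of A] by auto
      moreover obtain b where "b \<in> B" using AB by blast
      ultimately have "distinct [a, b, a']" "d a b = i" "d b a' = i" "a \<in> V" "b \<in> V" "a' \<in> V"
        using AB i i' by auto
      then show False using M False unfolding p3_free_def by metis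
    qed
    moreover have "card B \<le> 1"
    proof (rule ccontr)
      assume "\<not> card B \<le> 1"
      then obtain a a' where "a \<in> B" "a' \<in> B" "a \<noteq> a'" using card_ge_2E[of B] by auto
      moreover obtain b where "b \<in> A" using AB by blast
      ultimately have "distinct [a, b, a']" "d a b = i" "d b a' = i" "a \<in> V" "b \<in> V" "a' \<in> V"
        using AB i i' by auto
      then show False using M False unfolding p3_free_def by metis
    qed
    ultimately show ?thesis
      using cardV gr_bound_linear[of "card F + card C"] by linarith
  next
    case True
    consider "card A = 1" | "card B = 1" | "card A \<ge> 2" "card B \<ge> 2" using pos by linarith
    then show ?thesis
    proof cases
      case 1
      then obtain v where "A = {v}" by (auto simp: card_1_singleton_iff)
      then show ?thesis using bound_singleton[OF adm IH, of v B i] AB i True by auto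
    next
      case 2
      then obtain v where "B = {v}" by (auto simp: card_1_singleton_iff)
      then show ?thesis using bound_singleton[OF adm IH, of v A i] AB i' True by auto
    next
      case 3
      have "i \<notin> C"
      proof
        assume "i \<in> C"
        then have "c4_free (\<lambda>x y. d x y = i) V" using adm unfolding admissible_def by blast
        from join_c4_free[OF this sub(3,4) AB(3) 3(1) i] 3(2) show False by simp
      qed
      then have iF: "i \<in> F" and Ci: "C - {i} = C" using True by auto
      then have W: "w5_free (\<lambda>x y. d x y = i) V" using adm unfolding admissible_def by blast
      have "card A + card (C - {i}) \<le> gr_bound (card (F - {i}) + card (C - {i}))"
        using IH[OF sub(1) admissible_matching[OF adm sub(3)
          join_matching[OF W sub(4,3) _ 3(2) i']]] AB(3) by blast
      moreover have "card B + card (C - {i}) \<le> gr_bound (card (F - {i}) + card (C - {i}))"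
        using IH[OF sub(2) admissible_matching[OF adm sub(4)
          join_matching[OF W sub(3,4) AB(3) 3(1) i]]] .
      moreover have "card F = Suc (card (F - {i}))" by (rule card_Suc_Diff1[OF fin(2) iF, symmetric])
      ultimately show ?thesis
        using cardV gr_bound_Suc[of "card (F - {i}) + card C"] unfolding Ci by simp
    qed
  qed
qed
end

section \<open>Partitions with two colors between the parts\<close>

context
  fixes d :: "'a \<Rightarrow> 'a \<Rightarrow> nat"
  assumes sym: "\<And>x y. d x y = d y x"
begin

text \<open>If \<open>r\<close> were a matching color, an edge \<open>x y\<close> of color
  \<open>r\<close> between two parts would force both parts to be single vertices and all edges from
  \<open>{x, y}\<close> to the rest to have color \<open>b\<close>, a one-color split. Without such
  an edge, any part is split off in color \<open>b\<close>.\<close>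

lemma retraction_color_used:
  assumes adm: "admissible d F C V" and nosplit: "\<not> mono_split d V"
    and p: "gallai_retraction d V p r b"
  shows "r \<in> F \<union> C"
proof (rule ccontr)
  assume r: "r \<notin> F \<union> C"
  have M: "p3_free (\<lambda>x y. d x y \<notin> F \<union> C) V" using adm unfolding admissible_def by blast
  have pD: "d x y = d (p x) (p y) \<and> (d x y = r \<or> d x y = b)"
    if "x \<in> V" "y \<in> V" "p x \<noteq> p y" for x y
    using p that unfolding gallai_retraction_def by blast
  have P: False if "u \<in> V" "v \<in> V" "w \<in> V" "distinct [u, v, w]" "d u v = r" "d v w = r" for u v w
  proof -
    have "d u v \<notin> F \<union> C" "d v w \<notin> F \<union> C" using that(5,6) r by simp_all
    then show False using M that(1-4) unfolding p3_free_def by blast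
  qed
  obtain x0 y0 where x0: "x0 \<in> V" "y0 \<in> V" "p x0 \<noteq> p y0"
    using p unfolding gallai_retraction_def by blast
  have "\<exists>x\<in>V. \<exists>y\<in>V. p x \<noteq> p y \<and> d x y = r"
  proof (rule ccontr)
    assume "\<not> ?thesis"
    then have not_r: "d x y \<noteq> r" if "x \<in> V" "y \<in> V" "p x \<noteq> p y" for x y
      using that by blast
    have "mono_split d V"
    proof (rule mono_splitI)
      show "{x\<in>V. p x = p x0} \<noteq> {}" "{x\<in>V. p x \<noteq> p x0} \<noteq> {}" using x0 by (auto simp: eq_commute)
      show "{x\<in>V. p x = p x0} \<inter> {x\<in>V. p x \<noteq> p x0} = {}"
        "{x\<in>V. p x = p x0} \<union> {x\<in>V. p x \<noteq> p x0} = V" by auto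
      fix x y assume "x \<in> {x\<in>V. p x = p x0}" "y \<in> {x\<in>V. p x \<noteq> p x0}"
      then have "x \<in> V" "y \<in> V" "p x \<noteq> p y" by auto
      then show "d x y = b" using pD not_r by blast
    qed
    then show False using nosplit by simp
  qed
  then obtain x y where xy: "x \<in> V" "y \<in> V" "p x \<noteq> p y" "d x y = r" by blast
  have out: "d x z = b" if xy: "x \<in> V" "y \<in> V" "p x \<noteq> p y" "d x y = r" and z: "z \<in> V" "z \<noteq> x" "z \<noteq> y"
    for x y z
  proof -
    have "p z \<noteq> p x"
    proof
      assume "p z = p x"
      then have "d z y = r" using pD[of x y] pD[of z y] xy z by simp
      moreover have "distinct [x, y, z]" using xy z by auto
      ultimately show False using P[of x y z] xy(1,2,4) z(1) sym[of y z] by simp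
    qed
    then have "d x z = r \<or> d x z = b" using pD[of x z] xy z by auto
    moreover have "d z x \<noteq> r"
    proof
      assume "d z x = r"
      moreover have "distinct [z, x, y]" using xy z by auto
      ultimately show False using P[of z x y] xy(1,2,4) z(1) by simp
    qed
    ultimately show ?thesis using sym by metis
  qed
  have "x \<noteq> y" using xy by auto
  show False
  proof (cases "V = {x, y}")
    case True
    then have "mono_split d V" using mono_splitI[of "{x}" "{y}" V d r] xy(4) \<open>x \<noteq> y\<close> by auto
    then show False using nosplit by simp
  next
    case False
    then have "V - {x, y} \<noteq> {}" using xy(1,2) by auto
    moreover have "d y x = r" using xy(4) sym by metis
    then have "d u z = b" if "u \<in> {x, y}" "z \<in> V - {x, y}" for u z
      using that out[OF xy] out[OF xy(2,1) xy(3)[symmetric]] by blast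
    ultimately have "mono_split d V"
      using mono_splitI[of "{x, y}" "V - {x, y}" V d b] xy(1,2) by blast
    then show False using nosplit by simp
  qed
qed

lemma bound_two_colors:
  assumes adm: "admissible d F C V" and rb: "r \<in> F \<union> C" "b \<in> F \<union> C" "r \<noteq> b"
    and two: "\<And>x y. x \<in> V \<Longrightarrow> y \<in> V \<Longrightarrow> x \<noteq> y \<Longrightarrow> d x y = r \<or> d x y = b"
  shows "card V + card C \<le> gr_bound (card F + card C)"
proof -
  have fin: "finite V" "finite F" "finite C" "F \<inter> C = {}" using adm unfolding admissible_def by auto
  have K: "card F + card C = card (F \<union> C)" using fin card_Un_disjoint by metis
  have "card {r, b} \<le> card (F \<union> C)" using rb(1,2) fin(2,3) by (intro card_mono) auto
  then have K2: "card F + card C \<ge> 2" using rb(3) K by simp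
  have not: "w5_free (\<lambda>x y. d x y \<noteq> s) V"
    if "{s, t} = {r, b}" "w5_free (\<lambda>x y. d x y = t) V" for s t
    unfolding w5_free_def
  proof (intro ballI impI notI)
    fix h a b' c e assume V: "h \<in> V" "a \<in> V" "b' \<in> V" "c \<in> V" "e \<in> V" and
      dist: "distinct [h, a, b', c, e]" and
      n: "d h a \<noteq> s \<and> d h b' \<noteq> s \<and> d h c \<noteq> s \<and> d h e \<noteq> s \<and>
        d a b' \<noteq> s \<and> d b' c \<noteq> s \<and> d c e \<noteq> s \<and> d e a \<noteq> s"
    have eq: "d x y = t" if "x \<in> V" "y \<in> V" "x \<noteq> y" "d x y \<noteq> s" for x y
      using two[OF that(1-3)] that(4) \<open>{s, t} = {r, b}\<close> by (auto simp: doubleton_eq_iff)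
    have "d h a = t \<and> d h b' = t \<and> d h c = t \<and> d h e = t \<and>
        d a b' = t \<and> d b' c = t \<and> d c e = t \<and> d e a = t"
      by (intro conjI eq) (use V dist n in auto)
    then show False using that(2) V dist unfolding w5_free_def by blast
  qed
  have W: "w5_free (\<lambda>x y. d x y = r) V" "w5_free (\<lambda>x y. d x y = b) V"
    using admissible_w5_free[OF adm] rb by auto
  consider "r \<in> C" | "b \<in> C" | "r \<in> F" "b \<in> F" using rb by blast
  then show ?thesis
  proof cases
    case 1
    then have "c4_free (\<lambda>x y. d x y = r) V" using adm unfolding admissible_def by blast
    then have "card V \<le> 8"
      by (rule nine_vertices) (use not[OF _ W(2)] sym fin in auto)
    then show ?thesis using gr_bound_ge_12[OF K2] by linarith
  next
    case 2
    then have "c4_free (\<lambda>x y. d x y = b) V" using adm unfolding admissible_def by blast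
    then have "card V \<le> 8"
      by (rule nine_vertices) (use not[OF _ W(1)] sym fin in auto)
    then show ?thesis using gr_bound_ge_12[OF K2] by linarith
  next
    case 3
    have "card {r, b} \<le> card F" using 3 fin(2) by (intro card_mono) auto
    moreover have "card V \<le> 14"
      using W(1) by (rule fifteen_vertices) (use not[OF _ W(2)] sym fin in auto)
    ultimately show ?thesis using gr_bound_ge_12[OF K2] rb(3) by simp
  qed
qed

lemma bound_two_matchings:
  assumes adm: "admissible d F C V"
    and IH: "\<And>U F C. U \<subset> V \<Longrightarrow> admissible d F C U \<Longrightarrow> card U + card C \<le> gr_bound (card F + card C)"
    and U: "U \<subset> V" and rb: "r \<in> F" "b \<in> F" "r \<noteq> b"
    and M: "p3_free (\<lambda>x y. d x y = r) U" "p3_free (\<lambda>x y. d x y = b) U"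
  shows "card U + card C \<le> gr_bound (card F + card C - 2)"
proof -
  have fin: "finite F" "finite C" "F \<inter> C = {}" using adm unfolding admissible_def by auto
  have "U \<subseteq> V" using U by auto
  have C: "C - {r} = C" "C - {b} = C" using rb fin by auto
  have "admissible d (F - {r} - {b}) C U"
    using admissible_matching[OF sym admissible_matching[OF sym adm \<open>U \<subseteq> V\<close> M(1)] order_refl M(2)]
    unfolding C .
  from IH[OF U this] have "card U + card C \<le> gr_bound (card (F - {r} - {b}) + card C)" .
  moreover have "card (F - {r} - {b}) = card F - 2" using rb fin by (simp add: card_Diff_singleton_if)
  moreover have "card {r, b} \<le> card F" using rb(1,2) fin by (intro card_mono) auto
  ultimately show ?thesis using rb(3) by simp
qed

end

section \<open>A largest part and its two neighborhoods\<close>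

definition part :: "('a \<Rightarrow> 'a) \<Rightarrow> 'a set \<Rightarrow> 'a \<Rightarrow> 'a set" where
  "part p V a = {x \<in> V. p x = p a}"

text \<open>For a Gallai partition this set is the same for all vertices of the part of
  \<open>a\<close>.\<close>

definition nbhd :: "('a \<Rightarrow> 'a \<Rightarrow> nat) \<Rightarrow> ('a \<Rightarrow> 'a) \<Rightarrow> 'a set \<Rightarrow> nat \<Rightarrow> 'a \<Rightarrow> 'a set" where
  "nbhd d p V i a = {x \<in> V. p x \<noteq> p a \<and> d a x = i}"

context
  fixes d :: "'a \<Rightarrow> 'a \<Rightarrow> nat" and F C :: "nat set" and V :: "'a set" and p :: "'a \<Rightarrow> 'a"
  assumes sym: "\<And>x y. d x y = d y x"
    and adm: "admissible d F C V"
    and IH: "\<And>U F C. U \<subset> V \<Longrightarrow> admissible d F C U \<Longrightarrow> card U + card C \<le> gr_bound (card F + card C)"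
    and nosplit: "\<not> mono_split d V"
begin

lemma retractionD:
  assumes "gallai_retraction d V p r b" "x \<in> V" "y \<in> V" "p x \<noteq> p y"
  shows "d x y = d (p x) (p y)" "d x y = r \<or> d x y = b"
  using assms unfolding gallai_retraction_def by blast+

lemma part_nbhd_color:
  assumes "gallai_retraction d V p r b" "a \<in> V" "v \<in> part p V a" "x \<in> nbhd d p V i a"
  shows "d v x = i"
  using assms retractionD(1)[OF assms(1), of v x] retractionD(1)[OF assms(1), of a x]
  unfolding part_def nbhd_def by auto

lemma part_nbhd_sets:
  assumes "gallai_retraction d V p r b" "a \<in> V"
  shows "part p V a \<subseteq> V" "nbhd d p V i a \<subseteq> V" "part p V a \<inter> nbhd d p V i a = {}"
    "a \<in> part p V a" "part p V a \<union> nbhd d p V r a \<union> nbhd d p V b a = V"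
    "nbhd d p V r a \<inter> nbhd d p V b a = {}"
proof -
  have "r \<noteq> b" using assms(1) unfolding gallai_retraction_def by blast
  moreover have "d a x = r \<or> d a x = b" if "x \<in> V" "p x \<noteq> p a" for x
    using retractionD(2)[OF assms that(1)] that(2) by simp
  ultimately show "part p V a \<union> nbhd d p V r a \<union> nbhd d p V b a = V"
    "nbhd d p V r a \<inter> nbhd d p V b a = {}"
    using assms(2) unfolding part_def nbhd_def by blast+
qed (use assms(2) in \<open>auto simp: part_def nbhd_def\<close>)

text \<open>Otherwise \<open>b\<close> alone would join the part of \<open>a\<close> to everything
  else, a one-color split.\<close>

lemma nbhd_nonempty:
  assumes p: "gallai_retraction d V p r b" and a: "a \<in> V"
  shows "nbhd d p V r a \<noteq> {}"
proof
  assume "nbhd d p V r a = {}"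
  note S = part_nbhd_sets[OF p a]
  have "part p V a \<union> nbhd d p V b a = V" using S(5) \<open>nbhd d p V r a = {}\<close> by simp
  moreover have "nbhd d p V b a \<noteq> {}"
  proof
    assume "nbhd d p V b a = {}"
    then have "part p V a = V" using calculation by simp
    then have "p x = p a" if "x \<in> V" for x using that unfolding part_def by auto
    then show False using p unfolding gallai_retraction_def by metis
  qed
  moreover have "\<forall>v\<in>part p V a. \<forall>x\<in>nbhd d p V b a. d v x = b"
    using part_nbhd_color[OF p a] by blast
  ultimately have "mono_split d V"
    unfolding mono_split_def using S(3,4)
    by (intro exI[of _ "part p V a"] exI[of _ "nbhd d p V b a"]) auto
  then show False using nosplit by simp
qed

text \<open>Color \<open>b\<close> is a matching inside the neighborhood. If no two of its vertices
  share a part, all edges of other colors have color \<open>r\<close>, and \<open>card_le_4\<close>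
  applies. Otherwise a part \<open>X\<close> with two vertices can be joined to the rest
  \<open>D\<close> only in color \<open>r\<close>. Either \<open>D\<close> has at most one vertex
  and \<open>X\<close> is bounded by the largest part, or \<open>r\<close> is also a matching inside
  \<open>X\<close> and \<open>D\<close>, which are then two instances without \<open>r\<close> and
  \<open>b\<close>.\<close>

lemma card_nbhd:
  assumes p: "gallai_retraction d V p r b" and rb: "r \<in> F \<union> C" "b \<in> F \<union> C" and a: "a \<in> V"
    and big: "card (part p V a) \<ge> 2"
    and max: "\<And>x. x \<in> V \<Longrightarrow> card (part p V x) \<le> card (part p V a)"
  shows "card (nbhd d p V b a) \<le> 2 * gr_bound (card F + card C - 2) \<or>
    card (nbhd d p V b a) \<le> card (part p V a) + 1"
proof -
  define B where "B = nbhd d p V b a"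
  have fin: "finite V" "finite F" "finite C" "F \<inter> C = {}" using adm unfolding admissible_def by auto
  have rb': "r \<noteq> b" using p unfolding gallai_retraction_def by simp
  have S: "part p V a \<subseteq> V" "B \<subseteq> V" "part p V a \<inter> B = {}" "a \<in> part p V a"
    using part_nbhd_sets[OF p a] unfolding B_def by auto
  have finB: "finite B" using S(2) fin(1) finite_subset by blast
  have join: "\<And>v x. v \<in> part p V a \<Longrightarrow> x \<in> B \<Longrightarrow> d v x = b"
    using part_nbhd_color[OF p a] unfolding B_def by blast
  note W = admissible_w5_free[OF adm]
  have Mb: "p3_free (\<lambda>x y. d x y = b) B"
    by (rule join_matching[OF sym W[OF rb(2)] S(1-3) big join])
  show ?thesis
  proof (cases "b \<in> C")
    case True
    then have "c4_free (\<lambda>x y. d x y = b) V" using adm unfolding admissible_def by blast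
    from join_c4_free[OF sym this S(1-3) big join] show ?thesis unfolding B_def by linarith
  next
    case False
    then have bF: "b \<in> F" using rb by simp
    show ?thesis
    proof (cases "\<exists>x\<in>B. \<exists>y\<in>B. x \<noteq> y \<and> p x = p y")
      case False
      have "p3_free (\<lambda>x y. d x y \<noteq> r) B"
        unfolding p3_free_def
      proof (intro ballI impI notI)
        fix x y z assume xyz: "x \<in> B" "y \<in> B" "z \<in> B" "distinct [x, y, z]" "d x y \<noteq> r \<and> d y z \<noteq> r"
        then have "p x \<noteq> p y" "p y \<noteq> p z" using False by auto
        then have "d x y = b" "d y z = b" using xyz S(2) retractionD(2)[OF p] by blast+
        then show False using Mb xyz unfolding p3_free_def by blast
      qed
      from card_le_4[OF finB w5_free_subset[OF W[OF rb(1)] S(2)] this] have "card B \<le> 4"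
        using sym by simp
      then show ?thesis
        using gr_bound_linear[of "card F + card C - 2"] unfolding B_def by linarith
    next
      case True
      then obtain x y where xy: "x \<in> B" "y \<in> B" "x \<noteq> y" "p x = p y" by blast
      define X where "X = part p V x"
      define D where "D = B - X"
      have xV: "x \<in> V" "y \<in> V" "p x \<noteq> p a" using xy S(2) unfolding B_def nbhd_def by auto
      have XB: "X \<subseteq> B"
      proof
        fix z assume "z \<in> X"
        then have z: "z \<in> V" "p z = p x" unfolding X_def part_def by auto
        then have "d a z = d a x"
          using retractionD(1)[OF p a, of z] retractionD(1)[OF p a, of x] xV by simp
        then show "z \<in> B" using z xV xy(1) unfolding B_def nbhd_def by auto
      qed
      have "{x, y} \<subseteq> X" using xy xV unfolding X_def part_def by auto
      then have X2: "card X \<ge> 2"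
        using card_mono[of X "{x, y}"] XB finB finite_subset xy(3) by fastforce
      have cardB: "card B = card X + card D"
        unfolding D_def using XB finB
        by (metis card_Diff_subset card_mono finite_subset le_add_diff_inverse)
      have joinX: "d v z = r" if v: "v \<in> X" and z: "z \<in> D" for v z
      proof -
        have zV: "z \<in> B" "z \<in> V" "p z \<noteq> p x" using z S(2) unfolding D_def X_def part_def by auto
        have vV: "v \<in> V" "p v = p x" using v unfolding X_def part_def by auto
        have eq: "d x z = d v z" "d y z = d v z"
          using retractionD(1)[OF p] vV zV xV xy(4) by metis+
        \<comment> \<open>Both \<open>x\<close> and \<open>y\<close> see \<open>z\<close> in the
          color of \<open>v z\<close>, so color \<open>b\<close> would contain the path
          \<open>x z y\<close>.\<close>
        have "d v z \<noteq> b"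
        proof
          assume "d v z = b"
          then have "d x z = b" "d z y = b" using eq sym by auto
          moreover have "distinct [x, z, y]" using xy zV by auto
          ultimately show False using Mb xy zV unfolding p3_free_def by blast
        qed
        then show ?thesis using retractionD(2)[OF p, of v z] vV zV by auto
      qed
      show ?thesis
      proof (cases "card D \<le> 1")
        case True
        then show ?thesis using cardB max[OF xV(1)] unfolding X_def B_def by linarith
      next
        case False
        then have D2: "card D \<ge> 2" by simp
        have sub: "X \<subseteq> V" "D \<subseteq> V" "X \<inter> D = {}" "D \<inter> X = {}" "D \<subseteq> B" using XB S(2) unfolding D_def by auto
        have "r \<notin> C"
        proof
          assume "r \<in> C"
          then have "c4_free (\<lambda>x y. d x y = r) V" using adm unfolding admissible_def by blast
          from join_c4_free[OF sym this sub(1-3) X2 joinX] D2 show False by simp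
        qed
        then have rF: "r \<in> F" using rb by simp
        have "p3_free (\<lambda>x y. d x y = r) D"
          by (rule join_matching[OF sym W[OF rb(1)] sub(1-3) X2 joinX])
        moreover have "p3_free (\<lambda>x y. d x y = r) X"
          by (rule join_matching[OF sym W[OF rb(1)] sub(2,1,4) D2]) (use joinX sym in metis)
        moreover have "a \<notin> B" using S(3,4) by auto
        then have "X \<subset> V" "D \<subset> V" using XB sub S(2) a by auto
        ultimately have "card X + card C \<le> gr_bound (card F + card C - 2)"
          "card D + card C \<le> gr_bound (card F + card C - 2)"
          using bound_two_matchings[OF sym adm IH _ rF bF rb'] p3_free_subset[OF Mb] XB sub(5)
          by blast+
        then show ?thesis using cardB unfolding B_def by linarith
      qed
    qed
  qed
qed

text \<open>On the part of \<open>a\<close>, color \<open>b\<close> is a matching, but the single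
  neighbor in color \<open>r\<close> only makes \<open>r\<close> 4-cycle-free, or a matching if it
  was in \<open>C\<close>. So the part is an instance with one color less, and the summand 1 in
  \<open>cardA\<close> pays for the neighbor. Both alternatives of \<open>card_nbhd\<close> keep the
  other neighborhood within \<open>gr_bound (Suc k)\<close>.\<close>

lemma bound_single_neighbor:
  assumes p: "gallai_retraction d V p r b" and rb: "r \<in> F \<union> C" "b \<in> F \<union> C" and a: "a \<in> V"
    and big: "card (part p V a) \<ge> 2"
    and max: "\<And>x. x \<in> V \<Longrightarrow> card (part p V x) \<le> card (part p V a)"
    and single: "card (nbhd d p V r a) = 1" and "card (nbhd d p V b a) \<ge> 2"
  shows "card V + card C \<le> gr_bound (card F + card C)"
proof -
  define A where "A = part p V a"
  define R where "R = nbhd d p V r a"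
  define B where "B = nbhd d p V b a"
  have fin: "finite V" "finite F" "finite C" "F \<inter> C = {}" using adm unfolding admissible_def by auto
  have rb': "r \<noteq> b" using p unfolding gallai_retraction_def by simp
  have S: "A \<subseteq> V" "R \<subseteq> V" "B \<subseteq> V" "A \<inter> R = {}" "A \<inter> B = {}" "R \<inter> B = {}" "A \<union> R \<union> B = V" "a \<in> A"
    using part_nbhd_sets[OF p a] unfolding A_def R_def B_def by auto
  have fins: "finite A" "finite R" "finite B" using S(1-3) fin(1) finite_subset by blast+
  have "card V = card (A \<union> R) + card B"
    using S(4-7) fins by (metis Int_Un_distrib2 Un_empty card_Un_disjoint finite_UnI)
  then have cardV: "card V = card A + 1 + card B"
    using S(4) fins single unfolding R_def[symmetric] by (simp add: card_Un_disjoint)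
  have joinB: "\<And>x v. x \<in> B \<Longrightarrow> v \<in> A \<Longrightarrow> d x v = b" "\<And>v x. v \<in> A \<Longrightarrow> x \<in> B \<Longrightarrow> d v x = b"
    using part_nbhd_color[OF p a] sym unfolding A_def B_def by metis+
  obtain x where x: "R = {x}" using single unfolding R_def by (auto simp: card_1_singleton_iff)
  have xV: "x \<in> V" "A \<subseteq> V - {x}" using x S by auto
  have joinR: "\<And>v. v \<in> A \<Longrightarrow> d x v = r"
    using part_nbhd_color[OF p a] sym x unfolding A_def R_def by (metis singletonI)
  have B2: "card B \<ge> 2" and A2: "card A \<ge> 2" using assms(8) big unfolding A_def B_def by auto
  have "b \<notin> C"
  proof
    assume "b \<in> C"
    then have "c4_free (\<lambda>x y. d x y = b) V" using adm unfolding admissible_def by blast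
    from join_c4_free[OF sym this S(1,3,5) A2 joinB(2)] B2 show False by simp
  qed
  then have bF: "b \<in> F" "C - {b} = C" using rb by auto
  have AV: "A \<subset> V" using S xV by auto
  have Mb: "p3_free (\<lambda>x y. d x y = b) A"
    using join_matching[OF sym admissible_w5_free[OF adm rb(2)] S(3,1) _ B2 joinB(1)] S(5) by blast
  have admA: "admissible d (F - {b}) C A"
    using admissible_matching[OF sym adm S(1) Mb] bF by simp
  have F1: "Suc (card (F - {b})) = card F" by (rule card_Suc_Diff1[OF fin(2) bF(1)])
  define k where "k = card F + card C - 2"
  have "card (insert r (insert b {})) \<le> card (F \<union> C)" using rb fin(2,3) by (intro card_mono) auto
  then have K: "card F + card C = Suc (Suc k)"
    using rb' fin card_Un_disjoint[of F C] unfolding k_def by simp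
  note g = gr_bound_Suc[of k] gr_bound_Suc[of "Suc k"] gr_bound_Suc_Suc[of k] gr_bound_linear[of k]
  have cardA: "card A + card C + 1 \<le> gr_bound (Suc k)"
  proof (cases "r \<in> C")
    case True
    then have "c4_free (\<lambda>x y. d x y = r) V" using adm unfolding admissible_def by blast
    then have "p3_free (\<lambda>x y. d x y = r) A"
      by (rule p3_free_neighbors[OF _ _ xV]) (use sym joinR in auto)
    from IH[OF AV admissible_matching[OF sym admA order_refl this]]
    have "card A + card (C - {r}) \<le> gr_bound (card (F - {b} - {r}) + card (C - {r}))" .
    moreover have "F - {b} - {r} = F - {b}" using True fin(4) by auto
    moreover have C1: "Suc (card (C - {r})) = card C" by (rule card_Suc_Diff1[OF fin(3) True])
    moreover have "card (F - {b}) + card (C - {r}) = k" using C1 F1 K by simp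
    ultimately show ?thesis using g by simp
  next
    case False
    then have rF: "r \<in> F - {b}" using rb rb' by auto
    have "w5_free (\<lambda>x y. d x y = r) V" by (rule admissible_w5_free[OF adm rb(1)])
    then have "c4_free (\<lambda>x y. d x y = r) A"
      by (rule c4_free_neighbors[OF _ xV]) (use joinR in auto)
    from IH[OF AV admissible_demote[OF admA order_refl rF this]]
    have "card A + card (insert r C) \<le> gr_bound (card (F - {b} - {r}) + card (insert r C))" .
    moreover have "card (insert r C) = Suc (card C)" using False fin by simp
    moreover have "Suc (card (F - {b} - {r})) = card (F - {b})"
      by (rule card_Suc_Diff1) (use rF fin in auto)
    then have "card (F - {b} - {r}) + Suc (card C) = Suc k" using F1 K by simp
    ultimately show ?thesis by simp
  qed
  have "card B \<le> 2 * gr_bound k \<or> card B \<le> card A + 1"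
    using card_nbhd[OF p rb a big max] unfolding A_def B_def k_def by blast
  then show ?thesis using cardV cardA g unfolding K by linarith
qed

lemma bound_retraction:
  assumes p: "gallai_retraction d V p r b" and card2: "card V \<ge> 2"
  shows "card V + card C \<le> gr_bound (card F + card C)"
proof -
  have p': "gallai_retraction d V p b r" by (rule gallai_retraction_commute[OF p])
  have fin: "finite V" "finite F" "finite C" "F \<inter> C = {}" using adm unfolding admissible_def by auto
  have rb': "r \<noteq> b" using p unfolding gallai_retraction_def by simp
  have rb: "r \<in> F \<union> C" "b \<in> F \<union> C"
    using retraction_color_used[OF sym adm nosplit] p p' by blast+
  have "V \<noteq> {}" using card2 by auto
  define m where "m = Max ((\<lambda>x. card (part p V x)) ` V)"
  have "m \<in> (\<lambda>x. card (part p V x)) ` V"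
    unfolding m_def using fin(1) \<open>V \<noteq> {}\<close> by (intro Max_in) auto
  then obtain a where a: "a \<in> V" "card (part p V a) = m" by auto
  have max: "card (part p V x) \<le> card (part p V a)" if "x \<in> V" for x
    unfolding a(2) m_def using fin(1) that by (intro Max_ge) auto
  show ?thesis
  proof (cases "card (part p V a) \<ge> 2")
    case False
    have "p x \<noteq> p y" if "x \<in> V" "y \<in> V" "x \<noteq> y" for x y
    proof
      assume "p x = p y"
      then have "{x, y} \<subseteq> part p V x" using that unfolding part_def by auto
      then have "card {x, y} \<le> card (part p V x)"
        using fin(1) unfolding part_def by (intro card_mono) auto
      then show False using max[OF that(1)] False that(3) by simp
    qed
    then show ?thesis
      using bound_two_colors[OF sym adm rb rb'] retractionD(2)[OF p] by blast
  next
    case True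
    define A where "A = part p V a"
    define R where "R = nbhd d p V r a"
    define B where "B = nbhd d p V b a"
    have S: "A \<subseteq> V" "R \<subseteq> V" "B \<subseteq> V" "A \<inter> R = {}" "A \<inter> B = {}" "R \<inter> B = {}" "A \<union> R \<union> B = V" "a \<in> A"
      using part_nbhd_sets[OF p a(1)] unfolding A_def R_def B_def by auto
    have fins: "finite A" "finite R" "finite B" using S(1-3) fin(1) finite_subset by blast+
    have "card V = card (A \<union> R) + card B"
      using S(4-7) fins by (metis Int_Un_distrib2 Un_empty card_Un_disjoint finite_UnI)
    then have cardV: "card V = card A + card R + card B"
      using S(4) fins by (simp add: card_Un_disjoint)
    have ne: "R \<noteq> {}" "B \<noteq> {}"
      using nbhd_nonempty[OF p a(1)] nbhd_nonempty[OF p' a(1)] unfolding R_def B_def by auto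
    then have pos: "card R > 0" "card B > 0" using fins by (simp_all add: card_gt_0_iff)
    have joinR: "\<And>v x. v \<in> A \<Longrightarrow> x \<in> R \<Longrightarrow> d v x = r" "\<And>x v. x \<in> R \<Longrightarrow> v \<in> A \<Longrightarrow> d x v = r"
      using part_nbhd_color[OF p a(1)] sym unfolding A_def R_def by metis+
    have joinB: "\<And>v x. v \<in> A \<Longrightarrow> x \<in> B \<Longrightarrow> d v x = b" "\<And>x v. x \<in> B \<Longrightarrow> v \<in> A \<Longrightarrow> d x v = b"
      using part_nbhd_color[OF p a(1)] sym unfolding A_def B_def by metis+
    consider "card R = 1" "card B = 1" | "card R = 1" "card B \<ge> 2" | "card R \<ge> 2" "card B = 1"
      | "card R \<ge> 2" "card B \<ge> 2" using pos by linarith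
    then show ?thesis
    proof cases
      case 1
      then obtain x y where xy: "R = {x}" "B = {y}" by (auto simp: card_1_singleton_iff)
      have xyV: "x \<in> V" "y \<in> V" "x \<noteq> y" using xy S by auto
      \<comment> \<open>\<open>a\<close> sees \<open>x\<close> and \<open>y\<close> in different
        colors, so they lie in different parts. The edge between them has color \<open>r\<close> or
        \<open>b\<close>, so \<open>x\<close> or \<open>y\<close> is joined to all other vertices in
        one color.\<close>
      have "p x \<noteq> p y"
      proof
        assume "p x = p y"
        moreover have "p x \<noteq> p a" "p y \<noteq> p a" using xy unfolding R_def B_def nbhd_def by auto
        ultimately have "d a x = d a y"
          using retractionD(1)[OF p a(1) xyV(1)] retractionD(1)[OF p a(1) xyV(2)] by simp
        then show False using joinR(1) joinB(1) S(8) xy rb' by auto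
      qed
      then have "d x y = r \<or> d x y = b" using retractionD(2)[OF p xyV(1,2)] by simp
      then have "mono_split d V"
      proof
        assume "d x y = r"
        moreover have "{x} \<union> (A \<union> B) = V" "{x} \<inter> (A \<union> B) = {}" using S xy by auto
        ultimately show ?thesis
          unfolding mono_split_def using joinR(2) xy S(8)
          by (intro exI[of _ "{x}"] exI[of _ "A \<union> B"]) auto
      next
        assume "d x y = b"
        moreover have "{y} \<union> (A \<union> R) = V" "{y} \<inter> (A \<union> R) = {}" using S xy by auto
        ultimately show ?thesis
          unfolding mono_split_def using joinB(2) xy S(8) sym
          by (intro exI[of _ "{y}"] exI[of _ "A \<union> R"]) auto
      qed
      then show ?thesis using nosplit by simp
    next
      case 2
      then show ?thesis
        using bound_single_neighbor[OF p rb a(1) True max] unfolding R_def B_def by blast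
    next
      case 3
      then show ?thesis
        using bound_single_neighbor[OF p' rb(2,1) a(1) True max] unfolding R_def B_def by blast
    next
      case 4
      have A2: "card A \<ge> 2" using True unfolding A_def .
      have "r \<notin> C"
      proof
        assume "r \<in> C"
        then have "c4_free (\<lambda>x y. d x y = r) V" using adm unfolding admissible_def by blast
        from join_c4_free[OF sym this S(1,2,4) A2 joinR(1)] 4 show False by simp
      qed
      moreover have "b \<notin> C"
      proof
        assume "b \<in> C"
        then have "c4_free (\<lambda>x y. d x y = b) V" using adm unfolding admissible_def by blast
        from join_c4_free[OF sym this S(1,3,5) A2 joinB(1)] 4 show False by simp
      qed
      ultimately have F: "r \<in> F" "b \<in> F" using rb by auto
      have M: "p3_free (\<lambda>x y. d x y = r) A" "p3_free (\<lambda>x y. d x y = b) A"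
        using join_matching[OF sym admissible_w5_free[OF adm rb(1)] S(2,1) _ 4(1) joinR(2)]
          join_matching[OF sym admissible_w5_free[OF adm rb(2)] S(3,1) _ 4(2) joinB(2)] S(4,5)
        by blast+
      define k where "k = card F + card C - 2"
      have "card (insert r (insert b {})) \<le> card F" using F fin(2) by (intro card_mono) auto
      then have K: "card F + card C = Suc (Suc k)" using rb' unfolding k_def by simp
      have "A \<subset> V" using S ne by auto
      then have cardA: "card A + card C \<le> gr_bound k"
        using bound_two_matchings[OF sym adm IH _ F rb' M] unfolding k_def by blast
      have "card B \<le> 2 * gr_bound k \<or> card B \<le> card A + 1"
        using card_nbhd[OF p rb a(1) True max] unfolding A_def B_def k_def by blast
      moreover have "card R \<le> 2 * gr_bound k \<or> card R \<le> card A + 1"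
        using card_nbhd[OF p' rb(2,1) a(1) True max] unfolding A_def R_def k_def by blast
      \<comment> \<open>The alternative \<open>card A + 1\<close> is at most
        \<open>2 * gr_bound k\<close> as well, so the total is at most
        \<open>5 * gr_bound k\<close>.\<close>
      ultimately show ?thesis
        using cardV cardA gr_bound_Suc_Suc[of k] gr_bound_linear[of k] unfolding K by linarith
    qed
  qed
qed

end

lemma card_admissible_le:
  assumes "\<And>x y. d x y = d y x" "admissible d F C V"
  shows "card V + card C \<le> gr_bound (card F + card C)"
  using assms(2)
proof (induction "card V" arbitrary: V F C rule: less_induct)
  case less
  have fin: "finite V" using less.prems unfolding admissible_def by blast
  have IH: "card U + card C' \<le> gr_bound (card F' + card C')"
    if "U \<subset> V" "admissible d F' C' U" for U F' C'
    using less.hyps[OF psubset_card_mono[OF fin that(1)] that(2)] .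
  consider "card V \<le> 1" | "card V \<ge> 2" "mono_split d V" | "card V \<ge> 2" "\<not> mono_split d V"
    by linarith
  then show ?case
  proof cases
    case 1
    then show ?thesis using gr_bound_linear[of "card F + card C"] by linarith
  next
    case 2
    then show ?thesis using bound_mono_split[OF assms(1) less.prems IH] by blast
  next
    case 3
    have "gallai d V" using less.prems unfolding admissible_def by blast
    then obtain p r b where "gallai_retraction d V p r b"
      using gallai_retraction_exists[OF fin _ assms(1) 3(2,1)] by blast
    then show ?thesis using bound_retraction[OF assms(1) less.prems IH 3(2) _ 3(1)] by blast
  qed
qed

section \<open>The lower bound\<close>

definition extremal :: "(nat \<Rightarrow> nat \<Rightarrow> nat) \<Rightarrow> nat \<Rightarrow> nat \<Rightarrow> bool" where
  "extremal d n k \<longleftrightarrow> (\<forall>x y. d x y = d y x) \<and> (\<forall>x<n. \<forall>y<n. x \<noteq> y \<longrightarrow> d x y < k) \<and>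
     gallai d {..<n} \<and> (\<forall>i. w5_free (\<lambda>x y. d x y = i) {..<n})"

section \<open>The coloring on 14 vertices\<close>

lemma w5_free_mono:
  assumes "w5_free s V" "\<And>x y. x \<in> V \<Longrightarrow> y \<in> V \<Longrightarrow> x \<noteq> y \<Longrightarrow> r x y \<Longrightarrow> s x y"
  shows "w5_free r V"
  unfolding w5_free_def
proof (intro ballI impI notI)
  fix h a b c e assume V: "h \<in> V" "a \<in> V" "b \<in> V" "c \<in> V" "e \<in> V" and
    dist: "distinct [h, a, b, c, e]" and
    r: "r h a \<and> r h b \<and> r h c \<and> r h e \<and> r a b \<and> r b c \<and> r c e \<and> r e a"
  have "s h a \<and> s h b \<and> s h c \<and> s h e \<and> s a b \<and> s b c \<and> s c e \<and> s e a"
    by (intro conjI assms(2)) (use V dist r in auto)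
  then show False using assms(1) V dist unfolding w5_free_def by blast
qed

text \<open>In a wheel with hub \<open>h\<close>, opposite rim vertices \<open>a\<close> and
  \<open>c\<close> have two common neighbors inside the neighborhood of \<open>h\<close>. Excluding
  this takes triples of vertices instead of quintuples.\<close>

definition no_w5_check :: "(nat \<Rightarrow> nat \<Rightarrow> bool) \<Rightarrow> nat \<Rightarrow> bool" where
  "no_w5_check r n \<longleftrightarrow> list_all (\<lambda>h. let N = filter (r h) [0..<n] in
     list_all (\<lambda>a. let M = filter (r a) N in
       list_all (\<lambda>c. a = c \<or> length (filter (r c) M) \<le> 1) N) N) [0..<n]"

lemma w5_free_if_check:
  assumes "no_w5_check r n" "\<And>x y. r x y = r y x"
  shows "w5_free r {..<n}"
  unfolding w5_free_def
proof (intro ballI impI notI)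
  fix h a b c e assume V: "h \<in> {..<n}" "a \<in> {..<n}" "b \<in> {..<n}" "c \<in> {..<n}" "e \<in> {..<n}" and
    dist: "distinct [h, a, b, c, e]" and
    r: "r h a \<and> r h b \<and> r h c \<and> r h e \<and> r a b \<and> r b c \<and> r c e \<and> r e a"
  define L where "L = filter (r c) (filter (r a) (filter (r h) [0..<n]))"
  have *: "\<forall>h\<in>set [0..<n]. \<forall>a\<in>set (filter (r h) [0..<n]). \<forall>c\<in>set (filter (r h) [0..<n]).
      a = c \<or> length (filter (r c) (filter (r a) (filter (r h) [0..<n]))) \<le> 1"
    using assms(1) unfolding no_w5_check_def Let_def list_all_iff .
  have "h \<in> set [0..<n]" "a \<in> set (filter (r h) [0..<n])" "c \<in> set (filter (r h) [0..<n])"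
    using V r by simp_all
  from *[THEN bspec, OF this(1), THEN bspec, OF this(2), THEN bspec, OF this(3)]
  have "length L \<le> 1" using dist unfolding L_def by simp
  moreover have "r c b" "r a e" using r assms(2)[of b c] assms(2)[of e a] by simp_all
  then have "b \<in> set L" "e \<in> set L" using V r unfolding L_def by simp_all
  then have "card {b, e} \<le> card (set L)" by (intro card_mono) simp_all
  then have "card {b, e} \<le> length L" using card_length[of L] by linarith
  ultimately show False using dist by simp
qed

text \<open>Differences are not reduced modulo the order, so \<open>D\<close> has to list every
  distance together with its negative.\<close>

definition circulant :: "nat list \<Rightarrow> nat \<Rightarrow> nat \<Rightarrow> bool" where
  "circulant D x y \<longleftrightarrow> max x y - min x y \<in> set D"

lemma circulant_commute: "circulant D x y = circulant D y x"
  unfolding circulant_def max.commute[of x y] min.commute[of x y] by (rule refl)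

text \<open>
  The Cayley graph of \<open>\<int>/14\<close> with connection set \<open>{\<plusminus>1, \<plusminus>3, \<plusminus>4}\<close> and its complement.
\<close>

lemma circulant_checks:
  "no_w5_check (circulant [1, 3, 4, 10, 11, 13]) 14"
  "no_w5_check (\<lambda>x y. x \<noteq> y \<and> \<not> circulant [1, 3, 4, 10, 11, 13] x y) 14"
  by code_simp+

lemma extremal_14: "\<exists>d. extremal d 14 2"
proof -
  define d where "d = (\<lambda>x y. if circulant [1, 3, 4, 10, 11, 13] x y then 0 else 1 :: nat)"
  have free: "w5_free (\<lambda>x y. d x y = i) {..<14}" for i
  proof -
    consider "i = 0" | "i = 1" | "i \<ge> 2" by linarith
    then show ?thesis
    proof cases
      case 1
      have "w5_free (circulant [1, 3, 4, 10, 11, 13]) {..<14}"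
        using circulant_checks(1) circulant_commute by (rule w5_free_if_check)
      then show ?thesis by (rule w5_free_mono) (simp add: d_def 1 split: if_splits)
    next
      case 2
      \<comment> \<open>The condition \<open>x \<noteq> y\<close> removes loops, which the check
        would count as common neighbors.\<close>
      have "w5_free (\<lambda>x y. x \<noteq> y \<and> \<not> circulant [1, 3, 4, 10, 11, 13] x y) {..<14}"
        using circulant_checks(2) by (rule w5_free_if_check) (use circulant_commute in blast)
      then show ?thesis
      proof (rule w5_free_mono)
        fix x y assume "x \<noteq> y" "d x y = i"
        then show "x \<noteq> y \<and> \<not> circulant [1, 3, 4, 10, 11, 13] x y" using 2 unfolding d_def by auto
      qed
    next
      case 3
      then have "d x y \<noteq> i" for x y unfolding d_def by auto
      then show ?thesis unfolding w5_free_def by simp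
    qed
  qed
  have two: "d x y = 0 \<or> d x y = 1" for x y unfolding d_def by simp
  have "gallai d {..<14}"
    unfolding gallai_def
  proof (intro ballI impI)
    fix x y z show "d x y = d y z \<or> d x y = d x z \<or> d y z = d x z"
      using two[of x y] two[of y z] two[of x z] by auto
  qed
  moreover have lt: "d x y < 2" for x y using two[of x y] by auto
  moreover have "d x y = d y x" for x y unfolding d_def using circulant_commute by simp
  ultimately have "extremal d 14 2" unfolding extremal_def using free by simp
  then show ?thesis by blast
qed

section \<open>Substitution of colorings\<close>

definition blow_up :: "(nat \<Rightarrow> nat \<Rightarrow> nat) \<Rightarrow> (nat \<Rightarrow> nat \<Rightarrow> nat) \<Rightarrow> nat \<Rightarrow> nat \<Rightarrow> nat \<Rightarrow> nat" where
  "blow_up e d n x y =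
     (if x div n = y div n then d (x mod n) (y mod n) else e (x div n) (y div n))"

text \<open>The outer colors \<open>k\<close> and \<open>k' - 1\<close> coincide when a single color
  is gained. A wheel in an old color stays in the block of its hub. In a new color, the hub and two
  consecutive rim vertices lie in three blocks and give a monochromatic triangle of
  \<open>e\<close>. A triangle meeting two blocks has two equal edges, one meeting three blocks has
  only two colors available.\<close>

lemma extremal_blow_up:
  fixes e :: "nat \<Rightarrow> nat \<Rightarrow> nat"
  assumes d: "extremal d n k" and n: "n > 0"
    and sym: "\<And>x y. e x y = e y x"
    and new: "\<And>x y. x < t \<Longrightarrow> y < t \<Longrightarrow> x \<noteq> y \<Longrightarrow> e x y = k \<or> e x y = k' - 1" and k': "k < k'"
    and triangle_free: "\<And>x y z. x < t \<Longrightarrow> y < t \<Longrightarrow> z < t \<Longrightarrow> distinct [x, y, z] \<Longrightarrow>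
      \<not> (e x y = e x z \<and> e x y = e y z)"
  shows "extremal (blow_up e d n) (t * n) k'"
proof -
  let ?d = "blow_up e d n"
  have dsym: "d x y = d y x" for x y using d unfolding extremal_def by blast
  have dk: "d x y < k" if "x < n" "y < n" "x \<noteq> y" for x y using d that unfolding extremal_def by blast
  have G: "gallai d {..<n}" and W: "w5_free (\<lambda>x y. d x y = i) {..<n}" for i
    using d unfolding extremal_def by blast+
  have block: "x div n < t" "x mod n < n" if "x < t * n" for x
    using that n by (simp_all add: less_mult_imp_div_less)
  have mod_neq: "x mod n \<noteq> y mod n" if "x \<noteq> y" "x div n = y div n" for x y
    using that by (metis div_mult_mod_eq)
  have inside: "?d x y < k" if "x \<noteq> y" "x div n = y div n" for x y
    using dk[of "x mod n" "y mod n"] mod_neq[OF that] that n unfolding blow_up_def by simp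
  have outside: "?d x y = e (x div n) (y div n)" if "x div n \<noteq> y div n" for x y
    using that unfolding blow_up_def by simp
  have outside_ge: "?d x y = k \<or> ?d x y = k' - 1" if "x < t * n" "y < t * n" "x div n \<noteq> y div n" for x y
    using new[OF block(1)[OF that(1)] block(1)[OF that(2)] that(3)] outside[OF that(3)] by simp
  have symm: "?d x y = ?d y x" for x y unfolding blow_up_def using sym dsym by simp
  have "?d x y < k'" if "x < t * n" "y < t * n" "x \<noteq> y" for x y
    using inside[OF that(3)] outside_ge[OF that(1,2)] k' by (cases "x div n = y div n") auto
  moreover have "gallai ?d {..<t * n}"
    unfolding gallai_def
  proof (intro ballI impI)
    fix x y z assume xyz: "x \<in> {..<t * n}" "y \<in> {..<t * n}" "z \<in> {..<t * n}" "distinct [x, y, z]"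
    consider "x div n = y div n" "y div n = z div n" | "x div n = y div n" "y div n \<noteq> z div n"
      | "x div n = z div n" "y div n \<noteq> z div n" | "y div n = z div n" "x div n \<noteq> z div n"
      | "x div n \<noteq> y div n" "x div n \<noteq> z div n" "y div n \<noteq> z div n" by metis
    then show "?d x y = ?d y z \<or> ?d x y = ?d x z \<or> ?d y z = ?d x z"
    proof cases
      case 1
      then show ?thesis
        using gallaiD[OF G, of "x mod n" "y mod n" "z mod n"] mod_neq xyz n
        unfolding blow_up_def by simp
    next
      case 5
      then have "?d x y = k \<or> ?d x y = k' - 1" "?d x z = k \<or> ?d x z = k' - 1"
        "?d y z = k \<or> ?d y z = k' - 1" using outside_ge xyz(1-3) by simp_all
      then show ?thesis by (elim disjE) simp_all
    qed (use outside sym in \<open>simp_all\<close>)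
  qed
  moreover have "w5_free (\<lambda>x y. ?d x y = i) {..<t * n}" for i
    unfolding w5_free_def
  proof (intro ballI impI notI)
    fix h a b c f assume V: "h \<in> {..<t * n}" "a \<in> {..<t * n}" "b \<in> {..<t * n}" "c \<in> {..<t * n}"
      "f \<in> {..<t * n}" and dist: "distinct [h, a, b, c, f]" and
      i: "?d h a = i \<and> ?d h b = i \<and> ?d h c = i \<and> ?d h f = i \<and> ?d a b = i \<and> ?d b c = i \<and>
        ?d c f = i \<and> ?d f a = i"
    show False
    proof (cases "i < k")
      case True
      have same: "x div n = h div n" if "x \<in> {a, b, c, f}" for x
      proof (rule ccontr)
        assume "x div n \<noteq> h div n"
        moreover have "x < t * n" "h < t * n" "?d h x = i" using that V i by auto
        ultimately have "i = k \<or> i = k' - 1" using outside_ge[of h x] by metis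
        then show False using True k' by linarith
      qed
      have eq: "d (x mod n) (y mod n) = ?d x y" if "x \<in> {h, a, b, c, f}" "y \<in> {h, a, b, c, f}" for x y
        using that same[of x] same[of y] unfolding blow_up_def by auto
      have "distinct [h mod n, a mod n, b mod n, c mod n, f mod n]"
        using dist mod_neq same by simp
      then show False
        using W[of i] i eq n unfolding w5_free_def
        by (metis (no_types, lifting) insertCI lessThan_iff mod_less_divisor)
    next
      case False
      have "x div n \<noteq> y div n" if "x \<noteq> y" "?d x y = i" for x y
        using inside[OF that(1)] that(2) False by auto
      then have "distinct [h div n, a div n, b div n]" using i dist by simp
      then show False
        using triangle_free[of "h div n" "a div n" "b div n"] block V i outside by auto
    qed
  qed
  ultimately show ?thesis unfolding extremal_def using symm by blast
qed

lemma extremal_exists: "k \<ge> 1 \<Longrightarrow> \<exists>d. extremal d (gr_bound k) k"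
proof (induction k rule: gr_bound.induct)
  case 2
  have "w5_free (\<lambda>x y. 0 = i) {..<4::nat}" for i :: nat
    unfolding w5_free_def
  proof (intro ballI impI notI)
    fix h a b c f :: nat
    assume V: "h \<in> {..<4}" "a \<in> {..<4}" "b \<in> {..<4}" "c \<in> {..<4}" "f \<in> {..<4}"
      "distinct [h, a, b, c, f]"
    then have "card (set [h, a, b, c, f]) = 5" by (simp only: distinct_card) simp
    moreover have "set [h, a, b, c, f] \<subseteq> {..<4}" using V by simp
    ultimately show False using card_mono[of "{..<4::nat}" "set [h, a, b, c, f]"] by simp
  qed
  then have "extremal (\<lambda>x y. 0) 4 1" unfolding extremal_def gallai_def by simp
  then show ?case by auto
next
  case 3
  then show ?case using extremal_14 by (simp add: numeral_2_eq_2)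
next
  case 4
  obtain d where "extremal d 14 2" using extremal_14 by blast
  \<comment> \<open>Two blocks contain no triangle of \<open>e\<close>, so a single new color
    suffices.\<close>
  from extremal_blow_up[OF this, of "\<lambda>x y. 2" 2 3] have "extremal (blow_up (\<lambda>x y. 2) d 14) (2 * 14) 3"
    by fastforce
  then show ?case by (auto simp: numeral_3_eq_3)
next
  case (5 n)
  define k where "k = Suc (Suc n)"
  obtain d where d: "extremal d (gr_bound k) k" using 5 unfolding k_def by auto
  \<comment> \<open>The pentagon in color \<open>k\<close> and its complement, again a pentagon, in
    color \<open>k + 1\<close>.\<close>
  define e where "e = (\<lambda>x y :: nat. if (x + 1) mod 5 = y \<or> (y + 1) mod 5 = x then k else k + 1)"
  have "gr_bound k > 0" using gr_bound_linear[of k] by linarith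
  then have "extremal (blow_up e d (gr_bound k)) (5 * gr_bound k) (Suc (Suc k))"
  proof (rule extremal_blow_up[OF d])
    show "e x y = e y x" for x y unfolding e_def by auto
    show "e x y = k \<or> e x y = Suc (Suc k) - 1" for x y unfolding e_def by auto
    show "\<not> (e x y = e x z \<and> e x y = e y z)" if "x < 5" "y < 5" "z < 5" "distinct [x, y, z]" for x y z
    proof -
      have five: "{..<5} = {0, 1, 2, 3, 4 :: nat}"
        by (simp add: lessThan_nat_numeral lessThan_Suc insert_commute)
      have "x \<in> {..<5}" "y \<in> {..<5}" "z \<in> {..<5}" using that(1-3) by simp_all
      then show ?thesis using that(4) unfolding five e_def by (elim insertE emptyE) simp_all
    qed
  qed simp
  then show ?case unfolding k_def by auto
qed simp

section \<open>Gallai-Ramsey numbers of the wheel\<close>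

lemma gr_bound_closed_form:
  "k \<ge> 1 \<Longrightarrow> gr_bound k + 1 = (if k = 1 then 5
     else if even k then 14 * 5 ^ ((k - 2) div 2) + 1
     else 28 * 5 ^ ((k - 3) div 2) + 1)"
proof (induction k rule: gr_bound.induct)
  case (5 n)
  then show ?case by (cases "even n") (auto elim!: evenE oddE)
qed auto

section \<open>Copies of the triangle and the wheel in terms of vertices\<close>

lemma rainbow_triangle_iff:
  "has_rainbow_copy c (complete_graph 3) (complete_graph m) \<longleftrightarrow> \<not> gallai (\<lambda>x y. c {x, y}) {..<m}"
proof -
  have three: "{..<3} = {0, 1, 2 :: nat}"
    by (simp add: lessThan_nat_numeral lessThan_Suc insert_commute)
  have E: "edges (complete_graph 3) = {{0, 1}, {0, 2}, {1, 2}}"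
    unfolding complete_graph_def three nsets_2_eq by (simp add: insert_commute insert_Diff_if)
  show ?thesis
  proof
    assume "has_rainbow_copy c (complete_graph 3) (complete_graph m)"
    then obtain \<phi> where copy: "is_copy \<phi> (complete_graph 3) (complete_graph m)"
      and inj: "inj_on (\<lambda>e. c (\<phi> ` e)) (edges (complete_graph 3))"
      unfolding has_rainbow_copy_def by blast
    from copy have "inj_on \<phi> {0, 1, 2}" "\<phi> ` {0, 1, 2} \<subseteq> {..<m}"
      unfolding is_copy_def complete_graph_def three by simp_all
    then have "distinct [\<phi> 0, \<phi> 1, \<phi> 2]" "\<phi> 0 < m" "\<phi> 1 < m" "\<phi> 2 < m"
      by (simp_all add: inj_on_def)
    moreover have "c {\<phi> 0, \<phi> 1} \<noteq> c {\<phi> 1, \<phi> 2}" "c {\<phi> 0, \<phi> 1} \<noteq> c {\<phi> 0, \<phi> 2}"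
      "c {\<phi> 1, \<phi> 2} \<noteq> c {\<phi> 0, \<phi> 2}"
      using inj unfolding E inj_on_def by (simp_all add: doubleton_eq_iff)
    ultimately show "\<not> gallai (\<lambda>x y. c {x, y}) {..<m}"
      unfolding gallai_def by (metis lessThan_iff)
  next
    assume "\<not> gallai (\<lambda>x y. c {x, y}) {..<m}"
    then obtain x y z where xyz: "x < m" "y < m" "z < m" "distinct [x, y, z]"
      "c {x, y} \<noteq> c {y, z}" "c {x, y} \<noteq> c {x, z}" "c {y, z} \<noteq> c {x, z}"
      unfolding gallai_def lessThan_iff by blast
    define \<phi> where "\<phi> = (\<lambda>i::nat. [x, y, z] ! i)"
    have \<phi>: "\<phi> 0 = x" "\<phi> 1 = y" "\<phi> 2 = z" unfolding \<phi>_def by simp_all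
    have "is_copy \<phi> (complete_graph 3) (complete_graph m)"
      unfolding is_copy_def E using xyz(1-4) \<phi>
      by (simp add: complete_graph_def three inj_on_def)
    moreover have "inj_on (\<lambda>e. c (\<phi> ` e)) (edges (complete_graph 3))"
      unfolding E inj_on_def using xyz(5-7) \<phi> by simp
    ultimately show "has_rainbow_copy c (complete_graph 3) (complete_graph m)"
      unfolding has_rainbow_copy_def by blast
  qed
qed

lemma mono_wheel_iff:
  "has_mono_copy c (wheel_graph 5) (complete_graph m) \<longleftrightarrow>
    (\<exists>i. \<not> w5_free (\<lambda>x y. c {x, y} = i) {..<m})"
proof -
  have four: "{..<4} = {0, 1, 2, 3 :: nat}"
    by (simp add: lessThan_nat_numeral lessThan_Suc insert_commute)
  have cycle: "cycle_graph 4 = ({0, 1, 2, 3}, {{0, 1}, {1, 2}, {2, 3}, {3, 0}})"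
  proof -
    have "{{i, (i + 1) mod 4} | i. i < 4} = (\<lambda>i. {i, (i + 1) mod 4}) ` {..<4::nat}"
      by (simp add: image_def lessThan_def Bex_def conj_commute)
    also have "\<dots> = {{0, 1}, {1, 2}, {2, 3}, {3, 0}}" unfolding four by (simp flip: numeral_2_eq_2)
    finally show ?thesis unfolding cycle_graph_def four by simp
  qed
  have hub: "complete_graph 1 = ({0}, {})"
    unfolding complete_graph_def nsets_2_eq by (simp add: lessThan_Suc)
  have W: "wheel_graph 5 =
    graph_join ({0}, {}) ({0, 1, 2, 3}, {{0, 1}, {1, 2}, {2, 3}, {3, 0}})"
    unfolding wheel_graph_def hub by (simp add: cycle)
  have Vw: "verts (wheel_graph 5) = {Inl 0, Inr 0, Inr 1, Inr 2, Inr 3}"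
    unfolding W graph_join_def by (simp add: Plus_def insert_commute)
  have Ew: "edges (wheel_graph 5) = {{Inl 0, Inr 0}, {Inl 0, Inr 1}, {Inl 0, Inr 2}, {Inl 0, Inr 3},
    {Inr 0, Inr 1}, {Inr 1, Inr 2}, {Inr 2, Inr 3}, {Inr 3, Inr 0}}"
  proof -
    have spokes: "{{Inl u, Inr v} | u v. u \<in> {0 :: nat} \<and> v \<in> A} = (\<lambda>v. {Inl 0, Inr v}) ` A"
      for A :: "nat set"
      by blast
    show ?thesis unfolding W graph_join_def fst_conv snd_conv spokes
      by (simp add: insert_commute)
  qed
  show ?thesis
  proof
    assume "has_mono_copy c (wheel_graph 5) (complete_graph m)"
    then obtain \<phi> i where copy: "is_copy \<phi> (wheel_graph 5) (complete_graph m)"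
      and i: "\<forall>e\<in>edges (wheel_graph 5). c (\<phi> ` e) = i"
      unfolding has_mono_copy_def by blast
    let ?h = "\<phi> (Inl 0)" and ?a = "\<phi> (Inr 0)" and ?b = "\<phi> (Inr 1)" and ?c = "\<phi> (Inr 2)"
      and ?d = "\<phi> (Inr 3)"
    have "inj_on \<phi> (verts (wheel_graph 5))" and sub: "\<phi> ` verts (wheel_graph 5) \<subseteq> {..<m}"
      using copy unfolding is_copy_def by (simp_all add: complete_graph_def)
    then have "distinct [?h, ?a, ?b, ?c, ?d]" unfolding Vw by (simp add: inj_on_def)
    moreover have "?h \<in> {..<m}" "?a \<in> {..<m}" "?b \<in> {..<m}" "?c \<in> {..<m}" "?d \<in> {..<m}"
      using sub unfolding Vw by simp_all
    moreover have "c {?h, ?a} = i \<and> c {?h, ?b} = i \<and> c {?h, ?c} = i \<and> c {?h, ?d} = i \<and>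
      c {?a, ?b} = i \<and> c {?b, ?c} = i \<and> c {?c, ?d} = i \<and> c {?d, ?a} = i"
      using i unfolding Ew by simp
    ultimately show "\<exists>i. \<not> w5_free (\<lambda>x y. c {x, y} = i) {..<m}"
      unfolding w5_free_def by blast
  next
    assume "\<exists>i. \<not> w5_free (\<lambda>x y. c {x, y} = i) {..<m}"
    then obtain i h a b e f where V: "h < m" "a < m" "b < m" "e < m" "f < m"
      "distinct [h, a, b, e, f]" and
      i: "c {h, a} = i" "c {h, b} = i" "c {h, e} = i" "c {h, f} = i"
      "c {a, b} = i" "c {b, e} = i" "c {e, f} = i" "c {f, a} = i"
      unfolding w5_free_def lessThan_iff by blast
    define \<phi> where "\<phi> = case_sum (\<lambda>_::nat. h) (\<lambda>j::nat. [a, b, e, f] ! j)"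
    have \<phi>: "\<phi> (Inl 0) = h" "\<phi> (Inr 0) = a" "\<phi> (Inr 1) = b" "\<phi> (Inr 2) = e" "\<phi> (Inr 3) = f"
      unfolding \<phi>_def by (simp_all add: numeral_eq_Suc)
    have "is_copy \<phi> (wheel_graph 5) (complete_graph m)"
      unfolding is_copy_def Vw Ew using V \<phi> by (simp add: complete_graph_def inj_on_def) (metis (no_types))
    moreover have "\<forall>e\<in>edges (wheel_graph 5). c (\<phi> ` e) = i"
      unfolding Ew using i \<phi> by simp
    ultimately show "has_mono_copy c (wheel_graph 5) (complete_graph m)"
      unfolding has_mono_copy_def by blast
  qed
qed

theorem theorem7:
  fixes k :: nat
  assumes "k \<ge> 1"
  shows "gallai_ramsey k (complete_graph 3) (wheel_graph 5) =
    (if k = 1 then 5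
     else if even k then 14 * 5 ^ ((k - 2) div 2) + 1
     else 28 * 5 ^ ((k - 3) div 2) + 1)"
proof -
  let ?P = "\<lambda>m. \<forall>c \<in> edges (complete_graph m) \<rightarrow> {..<k}.
    has_rainbow_copy c (complete_graph 3) (complete_graph m) \<or>
    has_mono_copy c (wheel_graph 5) (complete_graph m)"
  have edge: "{x, y} \<in> edges (complete_graph m) \<longleftrightarrow> x < m \<and> y < m \<and> x \<noteq> y" for x y m
    unfolding complete_graph_def by auto
  have "gallai_ramsey k (complete_graph 3) (wheel_graph 5) = gr_bound k + 1"
    unfolding gallai_ramsey_def
  proof (rule Least_equality)
    show "?P (gr_bound k + 1)"
    proof (rule ballI, rule ccontr)
      fix c assume c: "c \<in> edges (complete_graph (gr_bound k + 1)) \<rightarrow> {..<k}"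
        and neg: "\<not> (has_rainbow_copy c (complete_graph 3) (complete_graph (gr_bound k + 1)) \<or>
          has_mono_copy c (wheel_graph 5) (complete_graph (gr_bound k + 1)))"
      have "c {x, y} < k" if "x < gr_bound k + 1" "y < gr_bound k + 1" "x \<noteq> y" for x y
        using c edge that by blast
      then have "p3_free (\<lambda>x y. c {x, y} \<notin> {..<k} \<union> {}) {..<gr_bound k + 1}"
        unfolding p3_free_def by auto
      \<comment> \<open>At the start \<open>C\<close> is empty and every edge has a color below
        \<open>k\<close>, so the matching is empty too and the bound reads \<open>card V\<close>
        \<le> \<open>gr_bound k\<close>.\<close>
      then have "admissible (\<lambda>x y. c {x, y}) {..<k} {} {..<gr_bound k + 1}"
        using neg unfolding admissible_def rainbow_triangle_iff mono_wheel_iff by simp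
      from card_admissible_le[OF _ this] show False by (simp add: insert_commute)
    qed
  next
    fix m assume P: "?P m"
    show "gr_bound k + 1 \<le> m"
    proof (rule ccontr)
      assume "\<not> gr_bound k + 1 \<le> m"
      then have sub: "{..<m} \<subseteq> {..<gr_bound k}" by auto
      obtain d where d: "extremal d (gr_bound k) k" using extremal_exists assms by blast
      \<comment> \<open>\<open>Min\<close> and \<open>Max\<close> recover the two ends of an edge;
        their order does not matter because \<open>d\<close> is symmetric.\<close>
      define c where "c = (\<lambda>e. d (Min e) (Max e))"
      have c: "c {x, y} = d x y" for x y
        using d unfolding c_def extremal_def by (simp add: min_def max_def)
      have "c \<in> edges (complete_graph m) \<rightarrow> {..<k}"
      proof
        fix e assume "e \<in> edges (complete_graph m)"
        then obtain x y where "e = {x, y}" "x < m" "y < m" "x \<noteq> y"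
          unfolding complete_graph_def nsets_2_eq by auto
        then show "c e \<in> {..<k}" using d c sub unfolding extremal_def by auto
      qed
      moreover have "gallai (\<lambda>x y. c {x, y}) {..<m}" "w5_free (\<lambda>x y. c {x, y} = i) {..<m}" for i
        using gallai_subset[OF _ sub] w5_free_subset[OF _ sub] d unfolding c extremal_def by blast+
      ultimately show False
        using P unfolding rainbow_triangle_iff mono_wheel_iff by blast
    qed
  qed
  then show ?thesis using gr_bound_closed_form[OF assms] by simp
qed

end
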